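(* Let $f$ be an analytic and univalent (injective) function on the open unit disc $\mathbb{D}=\{z\in\mathbb{C}:|z|<1\}$ with Taylor expansion $f(z)=z+a_2z^2+a_3z^3+\cdots$, and let $\gamma_3$ be its third logarithmic coefficient, where the logarithmic coefficients $\gamma_n$ of $f$ are defined by $\log\frac{f(z)}{z}=2\sum_{n=1}^{\infty}\gamma_n z^n$ for $z\in\mathbb{D}$. Then $$|\gamma_3|\le \frac{\sqrt{133}}{15}=0.7688\ldots.$$
   Context: The class $\mathcal{S}$ consists of all functions $f$ that are analytic and univalent (injective) in the open unit disc $\mathbb{D}$ and normalized so that $f(0)=0$ and $f'(0)=1$, i.e. $f(z)=z+a_2z^2+a_3z^3+\cdots$. For such $f$, the function $f(z)/z$ (with value $1$ at $z=0$) is analytic and non-vanishing in $\mathbb{D}$, and $\log\frac{f(z)}{z}$ denotes its analytic logarithm with value $0$ at $z=0$. The logarithmic coefficients $\gamma_n$ of $f$ are defined by $\log\frac{f(z)}{z}=2\sum_{n=1}^{\infty}\gamma_n z^n$ in $\mathbb{D}$. In particular $\gamma_3=\frac{1}{2}\left(a_4-a_2a_3+\frac{1}{3}a_2^3\right)$. *)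

theory Defs
  imports "HOL-Complex_Analysis.Complex_Analysis"
begin

definition class_S :: "(complex \<Rightarrow> complex) set" where
  "class_S = {f. f holomorphic_on ball 0 1 \<and> inj_on f (ball 0 1) \<and> f 0 = 0 \<and> deriv f 0 = 1}"

definition quotient_id :: "(complex \<Rightarrow> complex) \<Rightarrow> complex \<Rightarrow> complex" where
  "quotient_id f z = (if z = 0 then 1 else f z / z)"

text \<open>
  The analytic logarithm of \<open>f(z)/z\<close> is the branch vanishing at \<open>0\<close>; composing with the
  principal branch \<open>Ln\<close> would be wrong, as \<open>f(z)/z\<close> may take negative real values.
\<close>

definition is_log_quotient :: "(complex \<Rightarrow> complex) \<Rightarrow> (complex \<Rightarrow> complex) \<Rightarrow> bool" where
  "is_log_quotient f L \<longleftrightarrow>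
     L holomorphic_on ball 0 1 \<and> L 0 = 0 \<and> (\<forall>z\<in>ball 0 1. exp (L z) = quotient_id f z)"

text \<open>The coefficients are indexed from \<open>1\<close>; the value \<open>\<gamma> 0\<close> is irrelevant.\<close>

definition log_coefficients :: "(complex \<Rightarrow> complex) \<Rightarrow> (nat \<Rightarrow> complex) \<Rightarrow> bool" where
  "log_coefficients f \<gamma> \<longleftrightarrow>
     (\<exists>L. is_log_quotient f L \<and>
        (\<forall>z\<in>ball 0 1. summable (\<lambda>n. \<gamma> (Suc n) * z ^ Suc n) \<and>
           L z = 2 * (\<Sum>n. \<gamma> (Suc n) * z ^ Suc n)))"

lemma log_coefficients_exist:
  assumes "f \<in> class_S"
  shows "\<exists>\<gamma>. log_coefficients f \<gamma>"
proof -
  have hol: "f holomorphic_on ball 0 1" and inj: "inj_on f (ball 0 1)"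
    and f0: "f 0 = 0" and d0: "deriv f 0 = 1"
    using assms by (auto simp: class_S_def)
  have q: "quotient_id f holomorphic_on ball 0 1"
    by (rule pole_theorem_open_0[OF hol, of 0]) (auto simp: quotient_id_def f0 d0)
  have nz: "quotient_id f z \<noteq> 0" if "z \<in> ball 0 1" for z
    using inj_onD[OF inj, of z 0] that f0 by (auto simp: quotient_id_def)
  obtain g where g: "g holomorphic_on ball 0 1"
    and eg: "\<And>z. z \<in> ball 0 1 \<Longrightarrow> exp (g z) = quotient_id f z"
    using holomorphic_logarithm_exists[OF convex_ball open_ball q nz, of 0] by auto
  define L where "L z = g z - g 0" for z
  have eg0: "exp (g 0) = 1" using eg[of 0] by (simp add: quotient_id_def)
  have "L holomorphic_on ball 0 1"
    unfolding L_def by (intro holomorphic_intros g)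
  then have L: "is_log_quotient f L"
    using eg eg0 by (simp add: is_log_quotient_def L_def exp_diff)
  define \<gamma> where "\<gamma> n = (deriv ^^ n) L 0 / fact n / 2" for n
  have "(\<lambda>n. \<gamma> (Suc n) * z ^ Suc n) sums (L z / 2)" if z: "z \<in> ball 0 1" for z
  proof -
    have "L holomorphic_on ball 0 1" using L by (simp add: is_log_quotient_def)
    from holomorphic_power_series[OF this z]
    have "(\<lambda>n. (deriv ^^ n) L 0 / fact n * (z - 0) ^ n / 2) sums (L z / 2)"
      by (rule sums_divide)
    then have "(\<lambda>n. \<gamma> n * z ^ n) sums (L z / 2)"
      by (simp add: \<gamma>_def algebra_simps)
    moreover have "\<gamma> 0 = 0" by (simp add: \<gamma>_def L_def)
    ultimately show ?thesis by (subst sums_Suc_iff) simp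
  qed
  then have "summable (\<lambda>n. \<gamma> (Suc n) * z ^ Suc n) \<and>
      L z = 2 * (\<Sum>n. \<gamma> (Suc n) * z ^ Suc n)" if "z \<in> ball 0 1" for z
  proof -
    from \<open>\<And>z. z \<in> ball 0 1 \<Longrightarrow> (\<lambda>n. \<gamma> (Suc n) * z ^ Suc n) sums (L z / 2)\<close>[OF that]
    have "summable (\<lambda>n. \<gamma> (Suc n) * z ^ Suc n)" "(\<Sum>n. \<gamma> (Suc n) * z ^ Suc n) = L z / 2"
      unfolding sums_iff by blast+
    then show ?thesis by (simp only:) simp
  qed
  with L show ?thesis
    unfolding log_coefficients_def by blast
qed

lemma is_log_quotient_unique:
  assumes "is_log_quotient f L" "is_log_quotient f M" "z \<in> ball 0 1"
  shows "L z = M z"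
proof -
  let ?D = "\<lambda>z. L z - M z"
  have "?D constant_on ball 0 1"
  proof (rule continuous_discrete_range_constant)
    show "continuous_on (ball 0 1) ?D"
      using assms by (intro continuous_on_diff holomorphic_on_imp_continuous_on)
        (simp_all add: is_log_quotient_def)
    fix x :: complex assume x: "x \<in> ball 0 1"
    have e: "exp (L y) = exp (M y)" if "y \<in> ball 0 1" for y
      using assms that by (simp add: is_log_quotient_def)
    show "\<exists>e>0. \<forall>y. y \<in> ball 0 1 \<and> ?D y \<noteq> ?D x \<longrightarrow> e \<le> norm (?D y - ?D x)"
    proof (intro exI[of _ "2 * pi"] conjI allI impI)
      fix y assume y: "y \<in> ball 0 1 \<and> ?D y \<noteq> ?D x"
      obtain m n :: int where "L y = M y + of_int (2 * m) * (of_real pi * \<i>)"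
        "L x = M x + of_int (2 * n) * (of_real pi * \<i>)"
        using e[of x] e[of y] x y unfolding exp_eq by (auto simp: mult.assoc)
      then have eq: "?D y - ?D x = of_int (2 * (m - n)) * (of_real pi * \<i>)"
        by (simp add: algebra_simps)
      with y have "m \<noteq> n" by auto
      then have "1 \<le> \<bar>m - n\<bar>" by linarith
      then have "1 \<le> \<bar>real_of_int (m - n)\<bar>" by linarith
      then have "2 * pi * 1 \<le> 2 * pi * \<bar>real_of_int (m - n)\<bar>"
        by (intro mult_left_mono) auto
      also have "\<dots> = norm (?D y - ?D x)"
        unfolding eq norm_mult norm_of_int of_int_mult abs_mult by simp
      finally show "2 * pi \<le> norm (?D y - ?D x)" by simp
    qed simp
  qed simp
  then obtain c where c: "\<And>z. z \<in> ball 0 1 \<Longrightarrow> ?D z = c"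
    unfolding constant_on_def by blast
  have "L 0 = 0" "M 0 = 0" using assms by (auto simp: is_log_quotient_def)
  with c[of 0] c[OF assms(3)] show ?thesis by simp
qed

lemma log_coefficients_unique:
  assumes "log_coefficients f \<gamma>" "log_coefficients f \<delta>" "n \<ge> 1"
  shows "\<gamma> n = \<delta> n"
proof -
  obtain L where L: "is_log_quotient f L"
    and sL: "\<forall>z\<in>ball 0 1. summable (\<lambda>n. \<gamma> (Suc n) * z ^ Suc n) \<and>
           L z = 2 * (\<Sum>n. \<gamma> (Suc n) * z ^ Suc n)"
    using assms(1) unfolding log_coefficients_def by (elim exE conjE)
  obtain M where M: "is_log_quotient f M"
    and sM: "\<forall>z\<in>ball 0 1. summable (\<lambda>n. \<delta> (Suc n) * z ^ Suc n) \<and>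
           M z = 2 * (\<Sum>n. \<delta> (Suc n) * z ^ Suc n)"
    using assms(2) unfolding log_coefficients_def by (elim exE conjE)
  define a where "a n = (if n = 0 then 0 else \<gamma> n - \<delta> n)" for n
  have s: "(\<lambda>n. a n * z ^ n) sums 0" if z: "z \<in> ball 0 1" for z
  proof -
    have g: "(\<lambda>n. \<gamma> (Suc n) * z ^ Suc n) sums (\<Sum>n. \<gamma> (Suc n) * z ^ Suc n)"
      using bspec[OF sL z] by (blast intro: summable_sums)
    have d: "(\<lambda>n. \<delta> (Suc n) * z ^ Suc n) sums (\<Sum>n. \<delta> (Suc n) * z ^ Suc n)"
      using bspec[OF sM z] by (blast intro: summable_sums)
    have "2 * (\<Sum>n. \<gamma> (Suc n) * z ^ Suc n) = 2 * (\<Sum>n. \<delta> (Suc n) * z ^ Suc n)"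
      using bspec[OF sL z] bspec[OF sM z] is_log_quotient_unique[OF L M z] by metis
    then have eq: "(\<Sum>n. \<gamma> (Suc n) * z ^ Suc n) - (\<Sum>n. \<delta> (Suc n) * z ^ Suc n) = 0"
      by (simp only: mult_cancel_left) simp
    have "(\<lambda>n. \<gamma> (Suc n) * z ^ Suc n - \<delta> (Suc n) * z ^ Suc n) sums 0"
      using sums_diff[OF g d] unfolding eq .
    moreover have "\<gamma> (Suc n) * z ^ Suc n - \<delta> (Suc n) * z ^ Suc n = a (Suc n) * z ^ Suc n" for n
      by (simp add: a_def left_diff_distrib)
    ultimately have "(\<lambda>n. a (Suc n) * z ^ Suc n) sums 0" by (simp only:)
    then show ?thesis by (subst (asm) sums_Suc_iff) (simp add: a_def)
  qed
  have s': "(\<lambda>n. a n * (z - 0) ^ n) sums 0" if "norm (z - 0) < 1" for z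
    using s[of z] that by simp
  have "a n = 0"
  proof (rule ccontr)
    assume an: "a n \<noteq> 0"
    show False
    proof (rule powser_0_nonzero[OF zero_less_one s' refl an])
      fix r :: real assume "0 < r" and r: "\<And>z::complex. z \<in> cball 0 r - {0} \<Longrightarrow> (0::complex) \<noteq> 0"
      then have "of_real r \<in> cball 0 r - {0::complex}" by simp
      from r[OF this] show False by (rule notE) (rule refl)
    qed (use assms(3) in simp_all)
  qed
  with assms(3) show ?thesis by (simp add: a_def)
qed

end

(*
  For an injective Phi on the disc with Phi(0) = 0 and a polynomial Q, the fundamental theorem of
  algebra splits Q(1/Phi) - a into factors 1/Phi - b.  Each has one pole and, by injectivity, at most
  one zero in |z| < r, so the curve Q(1/Phi(r e^(it))) winds a nonpositive number of times around
  every point a off it.  Averaging over a (Cauchy kernel and Fubini) shows that its signed area is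
  nonpositive, and Parseval turns this into an area theorem: if Q(1/Phi(z)) = sum c_n z^n is the
  Laurent expansion, then sum n |c_n|^2 <= 0.

  Let f(z) = z exp(2 (g_1 z + g_2 z^2 + ...)).  Phi = f and Q(w) = w give |2 (g_2 - g_1^2)| <= 1.
  For the odd transform Phi(z) = sqrt(f(z^2)), the polynomial Q(w) = -w^3/3 - 3 g_1 w is chosen so
  that g_3 is the coefficient of z^3, and one gets
    |g_2 + 3/2 g_1^2|^2 + 3 |g_3|^2 <= 4 |g_1|^2 + 1/3.
  With t = |g_1|^2, the first bound gives |g_2 + 3/2 g_1^2| >= (5 t - 1)/2, and maximising over t
  (at t = 13/25) yields |g_3|^2 <= 133/225.
*)
theory Submission
  imports Defs "HOL-Computational_Algebra.Fundamental_Theorem_Algebra"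
begin

section \<open>The Cauchy kernel integrated over a square\<close>

text \<open>The singularity is integrable, with a bound independent of where \<open>u\<close> sits
  in the interval. This is the one-dimensional factor of a product majorant for the Cauchy
  kernel.\<close>

lemma nn_integral_inverse_sqrt_le:
  fixes u M :: real
  assumes "\<bar>u\<bar> \<le> M"
  shows "(\<integral>\<^sup>+x. ennreal (indicator {-M..M} x / sqrt \<bar>x - u\<bar>) \<partial>lborel) \<le> ennreal (4 * sqrt (2 * M))"
proof -
  \<comment> \<open>One formula for the primitive on both sides of \<open>u\<close>: 2 sqrt(x - u)
    on the right, -2 sqrt(u - x) on the left, continuous at \<open>u\<close>.\<close>
  define F where "F x = 2 * (sqrt (max 0 (x - u)) - sqrt (max 0 (u - x)))" for x
  have M: "-M \<le> M" using assms by linarith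
  have der: "(F has_vector_derivative 1 / sqrt \<bar>x - u\<bar>) (at x)" if "x \<noteq> u" for x
  proof (cases "x > u")
    case True
    have "((\<lambda>x. 2 * sqrt (x - u)) has_real_derivative 1 / sqrt \<bar>x - u\<bar>) (at x)"
      using True by (auto intro!: derivative_eq_intros simp: field_simps)
    then have "(F has_real_derivative 1 / sqrt \<bar>x - u\<bar>) (at x)"
      by (rule has_field_derivative_transform_within_open[where S = "{u<..}"]) (use True in \<open>auto simp: F_def\<close>)
    then show ?thesis by (simp add: has_real_derivative_iff_has_vector_derivative)
  next
    case False
    have "((\<lambda>x. - 2 * sqrt (u - x)) has_real_derivative 1 / sqrt \<bar>x - u\<bar>) (at x)"
      using False that by (auto intro!: derivative_eq_intros simp: field_simps)
    then have "(F has_real_derivative 1 / sqrt \<bar>x - u\<bar>) (at x)"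
      by (rule has_field_derivative_transform_within_open[where S = "{..<u}"])
         (use False that in \<open>auto simp: F_def\<close>)
    then show ?thesis by (simp add: has_real_derivative_iff_has_vector_derivative)
  qed
  have cF: "continuous_on {-M..M} F"
    unfolding F_def by (intro continuous_intros)
  have "((\<lambda>x. 1 / sqrt \<bar>x - u\<bar>) has_integral (F M - F (-M))) {-M..M}"
    by (rule fundamental_theorem_of_calculus_interior_strong[where S = "{u}"])
       (use M der in \<open>auto simp: cF\<close>)
  from nn_integral_has_integral_lebesgue[OF _ this]
  have "(\<integral>\<^sup>+x. ennreal (indicator {-M..M} x / sqrt \<bar>x - u\<bar>) \<partial>lborel) = ennreal (F M - F (-M))"
    by simp
  also have "F M - F (-M) \<le> 4 * sqrt (2 * M)"
  proof -
    have "sqrt (M - u) \<le> sqrt (2 * M)" "sqrt (u + M) \<le> sqrt (2 * M)" using assms by auto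
    moreover have "F M = 2 * sqrt (M - u)" "F (-M) = - 2 * sqrt (u + M)"
      using assms by (auto simp: F_def max_def)
    ultimately show ?thesis by linarith
  qed
  then have "ennreal (F M - F (-M)) \<le> ennreal (4 * sqrt (2 * M))"
    by (rule ennreal_leI)
  finally show ?thesis .
qed

text \<open>At a height other than Im w the number w - (x + i y) is never real, so minus its
  logarithm is a primitive in x. At x = M this number lies in the left half-plane; passing to its
  negative costs i pi with a sign. What remains are two logarithms with arguments in the right
  half-plane, hence holomorphic in \<open>w\<close>, and a jump term.\<close>

lemma box_integral_Cauchy_kernel_row:
  assumes "norm w < M" "y \<noteq> Im w"
  shows "(LINT x:{-M..M}|lborel. 1 / (w - (of_real x + \<i> * of_real y))) =
     Ln (w + of_real M - \<i> * of_real y) - Ln (of_real M + \<i> * of_real y - w) - \<i> * pi * sgn (Im w - y)"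
proof -
  have ne: "w - (of_real x + \<i> * of_real y) \<notin> \<real>\<^sub>\<le>\<^sub>0" for x
    using assms(2) by (auto simp: complex_nonpos_Reals_iff)
  have ne0: "w - (of_real x + \<i> * of_real y) \<noteq> 0" for x
    using ne[of x] by force
  have "continuous_on {-M..M} (\<lambda>x. 1 / (w - (of_real x + \<i> * of_real y)))"
    by (intro continuous_intros) (use ne0 in auto)
  then have si: "set_integrable lborel {-M..M} (\<lambda>x. 1 / (w - (of_real x + \<i> * of_real y)))"
    unfolding set_integrable_def by (intro borel_integrable_compact) auto
  have M: "-M \<le> M" using assms(1) norm_ge_zero[of w] by linarith
  have "((\<lambda>x. 1 / (w - (of_real x + \<i> * of_real y))) has_integral 
      (- Ln (w - (of_real M + \<i> * of_real y)) - (- Ln (w - (of_real (-M) + \<i> * of_real y))))) {-M..M}"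
    using ne ne0
    by (intro fundamental_theorem_of_calculus[OF M])
       (auto intro!: derivative_eq_intros has_vector_derivative_real_field simp: divide_simps)
  then have "(LINT x:{-M..M}|lborel. 1 / (w - (of_real x + \<i> * of_real y))) = 
      Ln (w + of_real M - \<i> * of_real y) - Ln (- (of_real M + \<i> * of_real y - w))"
    using set_borel_integral_eq_integral(2)[OF si] by (simp add: integral_unique algebra_simps)
  moreover have "Ln (- (of_real M + \<i> * of_real y - w)) = 
     Ln (of_real M + \<i> * of_real y - w) + \<i> * pi * sgn (Im w - y)"
    using ne0[of M] assms(2) by (subst Ln_minus) (auto simp: sgn_if algebra_simps)
  ultimately show ?thesis by simp
qed

text \<open>Points are stored as (imaginary part, real part), so the inner integral runs along rows.
  If a, b are the coordinate distances to \<open>w\<close>, then a b <= a^2 + b^2 bounds the kernel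
  by 1/sqrt a times 1/sqrt b, and Tonelli separates the factors. The bound depends on
  \<open>M\<close> alone, which later gives joint integrability along a curve.\<close>

lemma box_nn_integral_Cauchy_kernel_le:
  fixes w :: complex
  assumes "norm w \<le> M"
  shows "(\<integral>\<^sup>+p. ennreal (norm (indicator ({-M..M} \<times> {-M..M}) p *\<^sub>R
            (1 / (w - (of_real (snd p) + \<i> * of_real (fst p)))))) \<partial>(lborel :: (real \<times> real) measure))
          \<le> ennreal ((4 * sqrt (2 * M))\<^sup>2)" (is "(\<integral>\<^sup>+p. ?k p \<partial>_) \<le> _")
proof -
  let ?B = "{-M..M}"
  have M: "\<bar>Re w\<bar> \<le> M" "\<bar>Im w\<bar> \<le> M"
    using assms abs_Re_le_cmod[of w] abs_Im_le_cmod[of w] by linarith+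
  have "0 \<le> M" using M by linarith
  \<comment> \<open>The coordinate lines through \<open>w\<close> are left out, since 1 / 0 = 0
    makes the majorant vanish there. They are null sets for the iterated integral.\<close>
  have le: "?k (y, x) \<le> ennreal (indicator ?B y / sqrt \<bar>y - Im w\<bar>) * ennreal (indicator ?B x / sqrt \<bar>x - Re w\<bar>)"
    if "x \<noteq> Re w" "y \<noteq> Im w" for x y
  proof -
    let ?d = "w - (of_real x + \<i> * of_real y)"
    have "\<bar>y - Im w\<bar> * \<bar>x - Re w\<bar> \<le> (cmod ?d)\<^sup>2"
    proof -
      have "0 \<le> (\<bar>y - Im w\<bar> - \<bar>x - Re w\<bar>)\<^sup>2 + (\<bar>y - Im w\<bar>\<^sup>2 + \<bar>x - Re w\<bar>\<^sup>2)" by simp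
      then show ?thesis unfolding cmod_power2 by (simp add: power2_eq_square algebra_simps)
    qed
    then have "sqrt \<bar>y - Im w\<bar> * sqrt \<bar>x - Re w\<bar> \<le> cmod ?d"
      by (simp add: real_le_lsqrt flip: real_sqrt_mult)
    then have "1 / cmod ?d \<le> 1 / (sqrt \<bar>y - Im w\<bar> * sqrt \<bar>x - Re w\<bar>)"
      using that by (intro divide_left_mono) (auto simp: complex_eq_iff intro!: mult_pos_pos)
    then show ?thesis
      by (auto simp: indicator_def norm_divide simp flip: ennreal_mult split: if_splits intro!: ennreal_leI)
  qed
  have "(\<integral>\<^sup>+p. ?k p \<partial>lborel) = (\<integral>\<^sup>+y. \<integral>\<^sup>+x. ?k (y, x) \<partial>lborel \<partial>lborel)"
    unfolding lborel_prod[symmetric]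
    by (rule lborel.nn_integral_fst[symmetric]) measurable
  also have "\<dots> \<le> (\<integral>\<^sup>+y. \<integral>\<^sup>+x. ennreal (indicator ?B y / sqrt \<bar>y - Im w\<bar>)
       * ennreal (indicator ?B x / sqrt \<bar>x - Re w\<bar>) \<partial>lborel \<partial>lborel)"
  proof (rule nn_integral_mono_AE, rule eventually_mono[OF AE_lborel_singleton[of "Im w"]])
    fix y assume "y \<noteq> Im w"
    then show "(\<integral>\<^sup>+x. ?k (y, x) \<partial>lborel) \<le> (\<integral>\<^sup>+x. ennreal (indicator ?B y / sqrt \<bar>y - Im w\<bar>)
       * ennreal (indicator ?B x / sqrt \<bar>x - Re w\<bar>) \<partial>lborel)"
      by (intro nn_integral_mono_AE eventually_mono[OF AE_lborel_singleton[of "Re w"]] le)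
  qed
  also have "\<dots> = (\<integral>\<^sup>+y. ennreal (indicator ?B y / sqrt \<bar>y - Im w\<bar>) \<partial>lborel) *
       (\<integral>\<^sup>+x. ennreal (indicator ?B x / sqrt \<bar>x - Re w\<bar>) \<partial>lborel)"
    by (simp add: nn_integral_cmult nn_integral_multc)
  also have "\<dots> \<le> ennreal (4 * sqrt (2 * M)) * ennreal (4 * sqrt (2 * M))"
    by (intro mult_mono nn_integral_inverse_sqrt_le M) auto
  also have "\<dots> = ennreal ((4 * sqrt (2 * M))\<^sup>2)"
    using \<open>0 \<le> M\<close> by (simp add: power2_eq_square flip: ennreal_mult)
  finally show ?thesis .
qed

lemma box_integrable_Cauchy_kernel:
  fixes w :: complex
  assumes "norm w \<le> M"
  shows "set_integrable (lborel :: (real \<times> real) measure) ({-M..M} \<times> {-M..M})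
            (\<lambda>p. 1 / (w - (of_real (snd p) + \<i> * of_real (fst p))))"
  unfolding set_integrable_def
proof (rule integrableI_bounded)
  show "(\<lambda>p. indicator ({-M..M} \<times> {-M..M}) p *\<^sub>R
          (1 / (w - (of_real (snd p) + \<i> * of_real (fst p))))) \<in> borel_measurable lborel"
    unfolding lborel_prod[symmetric] by measurable
qed (rule le_less_trans[OF box_nn_integral_Cauchy_kernel_le[OF assms]], simp)

text \<open>Both arguments have positive real part because |Re (w s)| < M, so they avoid the branch
  cut. Since \<open>y\<close> may vary with the parameter too, this covers both a fixed
  \<open>w\<close> and joint continuity in curve parameter and height.\<close>

lemma continuous_on_box_log:
  assumes "continuous_on S w" "continuous_on S y" "\<And>s. s \<in> S \<Longrightarrow> norm (w s) < M"
  shows "continuous_on S (\<lambda>s. Ln (w s + of_real M - \<i> * of_real (y s))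
     - Ln (of_real M + \<i> * of_real (y s) - w s))"
proof -
  have "w s + of_real M - \<i> * of_real (y s) \<notin> \<real>\<^sub>\<le>\<^sub>0" "of_real M + \<i> * of_real (y s) - w s \<notin> \<real>\<^sub>\<le>\<^sub>0"
    if "s \<in> S" for s
    using assms(3)[OF that] abs_Re_le_cmod[of "w s"] by (auto simp: complex_nonpos_Reals_iff)
  then show ?thesis
    by (intro continuous_intros assms) auto
qed

text \<open>When the rows are integrated over the height, the jump terms add up to -2 pi i Im w. The
  integrated kernel is thus a holomorphic function of \<open>w\<close> plus a multiple of Im w, and
  it is Im w dw that produces an area along a closed curve.\<close>

lemma box_integral_Cauchy_kernel:
  fixes w :: complex
  assumes "norm w < M"
  shows "(LINT p:{-M..M} \<times> {-M..M}|lborel. 1 / (w - (of_real (snd p) + \<i> * of_real (fst p)))) =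
     integral {-M..M} (\<lambda>y. Ln (w + of_real M - \<i> * of_real y) - Ln (of_real M + \<i> * of_real y - w))
     - 2 * pi * \<i> * Im w"
proof -
  let ?B = "{-M..M}"
  let ?k = "\<lambda>y x. 1 / (w - (of_real x + \<i> * of_real y))"
  let ?A = "\<lambda>y. Ln (w + of_real M - \<i> * of_real y) - Ln (of_real M + \<i> * of_real y - w)"
  have M: "\<bar>Im w\<bar> < M" using assms abs_Im_le_cmod[of w] by linarith
  have "continuous_on ?B ?A"
    using assms by (intro continuous_on_box_log) (auto intro!: continuous_intros)
  then have A: "set_integrable lborel ?B ?A"
    by (rule borel_integrable_atLeastAtMost')
  have sgn: "set_integrable lborel ?B (\<lambda>y. complex_of_real (sgn (Im w - y)))"
    unfolding set_integrable_def
    by (rule integrableI_bounded_set_indicator[where B = 1]) (use M in \<open>auto simp: sgn_if\<close>)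
  have "(LINT p:?B \<times> ?B|lborel. ?k (fst p) (snd p)) =
        (LINT y|lborel. LINT x|lborel. indicator (?B \<times> ?B) (y, x) *\<^sub>R ?k y x)"
    using lborel_pair.integral_fst'[of "\<lambda>p. indicator (?B \<times> ?B) p *\<^sub>R ?k (fst p) (snd p)"]
      box_integrable_Cauchy_kernel[OF less_imp_le[OF assms]]
    unfolding set_integrable_def set_lebesgue_integral_def by (simp add: lborel_prod)
  also have "\<dots> = (LINT y:?B|lborel. LINT x:?B|lborel. ?k y x)"
    unfolding set_lebesgue_integral_def by (simp add: indicator_times flip: scaleR_scaleR)
  also have "\<dots> = (LINT y:?B|lborel. ?A y - \<i> * pi * sgn (Im w - y))"
    unfolding set_lebesgue_integral_def[of _ ?B "\<lambda>y. LINT x:_|_. _ y x"] set_lebesgue_integral_def[of _ ?B "\<lambda>y. _ y - _ y"]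
    by (rule integral_cong_AE)
       (use AE_lborel_singleton[of "Im w"] box_integral_Cauchy_kernel_row[OF assms] in
         \<open>auto elim!: eventually_mono simp: set_lebesgue_integral_def\<close>)
  also have "\<dots> = (LINT y:?B|lborel. ?A y) - (LINT y:?B|lborel. \<i> * pi * sgn (Im w - y))"
    by (rule set_integral_diff(2)[OF A]) (use sgn in \<open>rule set_integrable_mult_right\<close>)
  also have "(LINT y:?B|lborel. ?A y) = integral ?B ?A"
    by (rule set_borel_integral_eq_integral(2)[OF A])
  also have "(LINT y:?B|lborel. \<i> * pi * sgn (Im w - y)) = 2 * pi * \<i> * Im w"
  proof -
    \<comment> \<open>The primitive is -|Im w - y|; its corner at y = Im w is the one exceptional
      point.\<close>
    have "((\<lambda>y. sgn (Im w - y)) has_integral (- \<bar>Im w - M\<bar> - - \<bar>Im w - - M\<bar>)) ?B"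
    proof (rule fundamental_theorem_of_calculus_interior_strong[where S = "{Im w}"])
      fix y assume y: "y \<in> {-M<..<M} - {Im w}"
      have "((\<lambda>x. - (sgn (Im w - y) * (Im w - x))) has_real_derivative sgn (Im w - y)) (at y)"
        by (auto intro!: derivative_eq_intros)
      then have "((\<lambda>y. - \<bar>Im w - y\<bar>) has_real_derivative sgn (Im w - y)) (at y)"
        by (rule has_field_derivative_transform_within_open
            [where S = "if y < Im w then {..<Im w} else {Im w<..}"]) (use y in \<open>auto simp: sgn_if split: if_splits\<close>)
      then show "((\<lambda>y. - \<bar>Im w - y\<bar>) has_vector_derivative sgn (Im w - y)) (at y)"
        by (simp add: has_real_derivative_iff_has_vector_derivative)
    qed (use M in \<open>auto intro!: continuous_intros\<close>)
    then have "((\<lambda>y. sgn (Im w - y)) has_integral 2 * Im w) ?B"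
      using M by simp
    from has_integral_of_real[OF this, where 'b = complex]
    have "(LINT y:?B|lborel. complex_of_real (sgn (Im w - y))) = of_real (2 * Im w)"
      using set_borel_integral_eq_integral(2)[OF sgn] by (simp add: integral_unique)
    then show ?thesis by simp
  qed
  finally show ?thesis by simp
qed


section \<open>Signed area of a closed curve from its winding numbers\<close>

text \<open>The integral in the conclusion is that of x dy - y dx, twice the signed area. Integrate
  dg / (g - a) over all \<open>a\<close> in a square around the curve: along the curve first, it
  gives 2 pi i times the winding number; over \<open>a\<close> first, it gives the area. So the area
  inherits the sign of the winding numbers.\<close>

lemma signed_area_nonpos:
  fixes g g' :: "real \<Rightarrow> complex"
  assumes der: "\<And>t. (g has_vector_derivative g' t) (at t)"
    and cont': "continuous_on UNIV g'"
    and closed: "g 1 = g 0"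
    and winding: "\<And>a. a \<notin> path_image g \<Longrightarrow> Re (winding_number g a) \<le> 0"
  shows "Im (integral {0..1} (\<lambda>t. cnj (g t) * g' t)) \<le> 0"
proof -
  have cont: "continuous_on UNIV g"
    using der by (meson continuous_at_imp_continuous_on has_vector_derivative_continuous)
  have [measurable]: "g \<in> borel_measurable borel" "g' \<in> borel_measurable borel"
    using cont cont' by (auto intro: borel_measurable_continuous_onI)
  have cont01: "continuous_on S g" "continuous_on S g'" for S
    using cont cont' continuous_on_subset by blast+
  have vp: "valid_path g"
    unfolding valid_path_def
    by (rule C1_differentiable_imp_piecewise) (use der cont01 in \<open>auto simp: C1_differentiable_on_def\<close>)
  have "bounded (g ` {0..1})" "bounded (g' ` {0..1})"
    by (auto intro!: compact_imp_bounded compact_continuous_image cont01)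
  then obtain M0 K where M0: "\<And>t. t \<in> {0..1} \<Longrightarrow> norm (g t) \<le> M0" and K: "\<And>t. t \<in> {0..1} \<Longrightarrow> norm (g' t) \<le> K"
    unfolding bounded_iff by blast
  \<comment> \<open>The margin 1 puts the curve strictly inside the square, as the logarithms of the
    row formula require.\<close>
  define M where "M = M0 + 1"
  have M: "norm (g t) < M" if "t \<in> {0..1}" for t using M0[OF that] by (simp add: M_def)
  define box where "box = {-M..M} \<times> {-M..M}"
  define C where "C = (4 * sqrt (2 * M))\<^sup>2"
  define k where "k w p = indicator box p *\<^sub>R (1 / (w - (of_real (snd p) + \<i> * of_real (fst p))))" 
    for w :: complex and p :: "real \<times> real"
  define \<Phi> where "\<Phi> t p = indicator {0..1} t *\<^sub>R (g' t * k (g t) p)" for t :: real and p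

  have meas: "case_prod \<Phi> \<in> borel_measurable (lborel \<Otimes>\<^sub>M (lborel :: (real \<times> real) measure))"
    unfolding \<Phi>_def k_def box_def lborel_prod[symmetric] by measurable
  \<comment> \<open>Absolute integrability for Fubini: the speed is at most \<open>K\<close>, and
    the kernel at any point of the curve has integral at most \<open>C\<close> over the
    square.\<close>
  have int: "integrable (lborel \<Otimes>\<^sub>M lborel) (case_prod \<Phi>)"
  proof (rule integrableI_bounded[OF meas])
    have "(\<integral>\<^sup>+q. norm (case_prod \<Phi> q) \<partial>(lborel \<Otimes>\<^sub>M lborel)) = (\<integral>\<^sup>+t. \<integral>\<^sup>+p. norm (\<Phi> t p) \<partial>lborel \<partial>lborel)"
      using lborel.nn_integral_fst[of "\<lambda>q. norm (case_prod \<Phi> q)" lborel] meas by simp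
    also have "\<dots> \<le> (\<integral>\<^sup>+t. ennreal (K * C) * indicator {0..1} t \<partial>(lborel :: real measure))"
    proof (rule nn_integral_mono)
      fix t :: real
      show "(\<integral>\<^sup>+p. norm (\<Phi> t p) \<partial>lborel) \<le> ennreal (K * C) * indicator {0..1} t"
      proof (cases "t \<in> {0..1}")
        case True
        have "(\<integral>\<^sup>+p. norm (\<Phi> t p) \<partial>lborel) = (\<integral>\<^sup>+p. norm (g' t) * ennreal (norm (k (g t) p)) \<partial>lborel)"
          using True by (simp add: \<Phi>_def norm_mult ennreal_mult)
        also have "\<dots> = norm (g' t) * (\<integral>\<^sup>+p. norm (k (g t) p) \<partial>lborel)"
          by (rule nn_integral_cmult) (simp add: k_def box_def borel_prod[symmetric])
        also have "\<dots> \<le> ennreal K * ennreal C"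
          using box_nn_integral_Cauchy_kernel_le[OF less_imp_le[OF M[OF True]]] K[OF True]
          by (intro mult_mono ennreal_leI) (auto simp: k_def box_def C_def)
        also have "\<dots> = ennreal (K * C)"
          using order_trans[OF norm_ge_zero K[OF True]] by (subst ennreal_mult) (auto simp: C_def)
        finally show ?thesis using True by simp
      qed (simp add: \<Phi>_def)
    qed
    also have "\<dots> < \<infinity>" by (simp add: nn_integral_cmult_indicator)
    finally show "(\<integral>\<^sup>+q. norm (case_prod \<Phi> q) \<partial>(lborel \<Otimes>\<^sub>M lborel)) < \<infinity>" .
  qed

  \<comment> \<open>\<open>J\<close> is the part of the averaged Cauchy kernel that is holomorphic in \<open>w\<close>, so it integrates to
    \<open>0\<close> along the closed curve; only \<open>- 2 \<pi> \<i> Im w\<close> survives, which yields the area.\<close>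
  define J where "J w = integral {-M..M} (\<lambda>y. Ln (w + of_real M - \<i> * of_real y)
      - Ln (of_real M + \<i> * of_real y - w))" for w
  have inner: "(LINT p|lborel. \<Phi> t p) = indicator {0..1} t *\<^sub>R (g' t * (J (g t) - 2 * pi * \<i> * Im (g t)))" for t
  proof (cases "t \<in> {0..1}")
    case True
    have "(LINT p|lborel. k (g t) p) = J (g t) - 2 * pi * \<i> * Im (g t)"
      using box_integral_Cauchy_kernel[OF M[OF True]]
      unfolding k_def box_def J_def set_lebesgue_integral_def by simp
    then show ?thesis using True by (simp add: \<Phi>_def)
  qed (simp add: \<Phi>_def)

  have cJ: "continuous_on {0..1} (\<lambda>t. J (g t))"
  proof -
    have "continuous_on (cbox 0 1 \<times> cbox (-M) M) (\<lambda>(t, y). Ln (g t + of_real M - \<i> * of_real y)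
      - Ln (of_real M + \<i> * of_real y - g t))"
      unfolding case_prod_unfold
      by (intro continuous_on_box_log)
         (use M in \<open>auto intro!: continuous_intros continuous_on_compose2[OF cont]\<close>)
    from integral_continuous_on_param[OF this] show ?thesis
      by (simp add: J_def)
  qed
  have J0: "integral {0..1} (\<lambda>t. g' t * J (g t)) = 0"
  proof -
    let ?A = "\<lambda>w y. Ln (w + of_real M - \<i> * of_real y) - Ln (of_real M + \<i> * of_real y - w)"
    have row: "integral {0..1} (\<lambda>t. g' t * ?A (g t) y) = 0" for y
    proof -
      have "w + of_real M - \<i> * of_real y \<notin> \<real>\<^sub>\<le>\<^sub>0" "of_real M + \<i> * of_real y - w \<notin> \<real>\<^sub>\<le>\<^sub>0"
        if "w \<in> ball 0 M" for w
        using that abs_Re_le_cmod[of w] by (auto simp: complex_nonpos_Reals_iff)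
      then have "(\<lambda>w. ?A w y) holomorphic_on ball 0 M"
        by (intro holomorphic_intros) auto
      then have "((\<lambda>w. ?A w y) has_contour_integral 0) g"
        by (rule Cauchy_theorem_convex_simple)
           (use vp M closed in \<open>auto simp: path_image_def pathfinish_def pathstart_def\<close>)
      then have "contour_integral g (\<lambda>w. ?A w y) = 0" by (rule contour_integral_unique)
      then show ?thesis
        using vector_derivative_at[OF der] by (simp add: contour_integral_integral mult.commute)
    qed
    have "integral {0..1} (\<lambda>t. g' t * J (g t)) = integral {0..1} (\<lambda>t. integral {-M..M} (\<lambda>y. g' t * ?A (g t) y))"
      by (simp add: J_def)
    also have "\<dots> = integral {-M..M} (\<lambda>y. integral {0..1} (\<lambda>t. g' t * ?A (g t) y))"
    proof -
      have "continuous_on (cbox (0, -M) (1, M)) (\<lambda>(t, y). g' t * ?A (g t) y)"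
        unfolding case_prod_unfold
        by (intro continuous_on_mult continuous_on_box_log)
           (use M in \<open>auto simp: cbox_Pair_eq intro!: continuous_intros continuous_on_compose2[OF cont] continuous_on_compose2[OF cont']\<close>)
      from integral_swap_continuous[OF this] show ?thesis by simp
    qed
    also have "\<dots> = 0" by (simp add: row)
    finally show ?thesis .
  qed

  have "(LINT p|lborel. LINT t|lborel. \<Phi> t p) = (LINT t|lborel. LINT p|lborel. \<Phi> t p)"
    by (rule lborel_pair.Fubini_integral[OF int])
  also have "\<dots> = (LINT t:{0..1}|lborel. g' t * (J (g t) - 2 * pi * \<i> * Im (g t)))"
    by (simp add: inner set_lebesgue_integral_def)
  also have "\<dots> = integral {0..1} (\<lambda>t. g' t * (J (g t) - 2 * pi * \<i> * Im (g t)))"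
    by (intro set_borel_integral_eq_integral borel_integrable_atLeastAtMost' continuous_intros cont01 cJ)
  also have "\<dots> = integral {0..1} (\<lambda>t. g' t * J (g t)) - integral {0..1} (\<lambda>t. g' t * (2 * pi * \<i> * Im (g t)))"
    unfolding right_diff_distrib
    by (intro integral_diff integrable_continuous_real continuous_intros cont01 cJ)
  also have "\<dots> = - (2 * pi * \<i>) * integral {0..1} (\<lambda>t. g' t * Im (g t))"
    using J0 by (simp add: mult.left_commute[of "g' _"])
  finally have total: "(LINT p|lborel. LINT t|lborel. \<Phi> t p) = - (2 * pi * \<i>) * integral {0..1} (\<lambda>t. g' t * Im (g t))" .

  \<comment> \<open>The curve is a differentiable image of a one-dimensional set, hence null in the
    plane, so points on it can be ignored when integrating winding numbers. Compactness makes it a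
    Borel set.\<close>
  have null: "AE p in lborel. of_real (snd p) + \<i> * of_real (fst p) \<notin> path_image g"
  proof -
    define N where "N = (\<lambda>t. (Im (g t), Re (g t))) ` {0..1}"
    have "compact N"
      unfolding N_def by (intro compact_continuous_image continuous_intros cont01) auto
    then have "N \<in> sets lborel" by (auto intro: borel_compact)
    moreover have "negligible N"
      unfolding N_def
      by (rule negligible_differentiable_image_lowdim)
         (use der in \<open>auto simp: differentiable_on_def has_vector_derivative_def 
           intro!: differentiableI[of _ "\<lambda>h. (Im (h *\<^sub>R g' _), Re (h *\<^sub>R g' _))"] derivative_eq_intros
           intro: has_derivative_at_withinI\<close>)
    ultimately have "AE p in lborel. p \<notin> N"
      by (auto simp: negligible_iff_null_sets null_sets_completion_iff intro: AE_not_in)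
    then show ?thesis
      by (rule eventually_mono) (force simp: N_def path_image_def complex_eq_iff image_iff)
  qed
  have nonpos: "AE p in lborel. Im (LINT t|lborel. \<Phi> t p) \<le> 0"
    using null
  proof (rule eventually_mono)
    fix p :: "real \<times> real"
    let ?a = "of_real (snd p) + \<i> * of_real (fst p)"
    assume a: "?a \<notin> path_image g"
    show "Im (LINT t|lborel. \<Phi> t p) \<le> 0"
    proof (cases "p \<in> box")
      case True
      have ne: "g t - ?a \<noteq> 0" if "t \<in> {0..1}" for t
        using a that unfolding path_image_def by (metis imageI right_minus_eq)
      have "(LINT t|lborel. \<Phi> t p) = (LINT t:{0..1}|lborel. g' t * (1 / (g t - ?a)))"
        using True by (simp add: \<Phi>_def k_def set_lebesgue_integral_def)
      also have "\<dots> = integral {0..1} (\<lambda>t. g' t * (1 / (g t - ?a)))"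
        by (intro set_borel_integral_eq_integral borel_integrable_atLeastAtMost' continuous_intros cont01 ballI ne)
      also have "\<dots> = 2 * pi * \<i> * winding_number g ?a"
        using winding_number_valid_path[OF vp a] vector_derivative_at[OF der]
        by (simp add: contour_integral_integral mult.commute)
      finally show ?thesis using winding[OF a] by (simp add: mult_le_0_iff)
    qed (simp add: \<Phi>_def k_def)
  qed
  have "integrable lborel (\<lambda>p. LINT t|lborel. \<Phi> t p)"
    by (rule lborel_pair.integrable_snd[OF int])
  then have "Im (LINT p|lborel. LINT t|lborel. \<Phi> t p) = (LINT p|lborel. Im (LINT t|lborel. \<Phi> t p))"
    by simp
  also have "\<dots> \<le> 0"
    using integral_nonneg_AE[of "\<lambda>p. - Im (LINT t|lborel. \<Phi> t p)" lborel] nonpos by simp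
  \<comment> \<open>By \<open>total\<close> the averaged quantity is -2 pi i times the integral of
    Im g dg, so a nonpositive imaginary part means that this integral has nonnegative real
    part.\<close>
  finally have "Re (integral {0..1} (\<lambda>t. g' t * Im (g t))) \<ge> 0"
    unfolding total using pi_gt_zero by (auto simp: zero_le_mult_iff simp del: pi_gt_zero)
  moreover have "Re (integral {0..1} (\<lambda>t. g' t * Im (g t))) = integral {0..1} (\<lambda>t. Re (g' t) * Im (g t))"
  proof -
    have "(\<lambda>t. g' t * Im (g t)) integrable_on {0..1}"
      by (intro integrable_continuous_real continuous_intros cont01)
    from integral_linear[OF this bounded_linear_Re] show ?thesis by (simp add: o_def)
  qed
  ultimately have XY: "integral {0..1} (\<lambda>t. Re (g' t) * Im (g t)) \<ge> 0" by simp
  \<comment> \<open>The curve is closed, so d(x y) integrates to 0; hence x dy and -y dx have the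
    same integral, and the sign of one decides the sign of the area.\<close>
  have "((\<lambda>t. Re (g' t) * Im (g t) + Re (g t) * Im (g' t)) has_integral 
      Re (g 1) * Im (g 1) - Re (g 0) * Im (g 0)) {0..1}"
  proof (rule fundamental_theorem_of_calculus)
    fix t :: real
    have d: "((\<lambda>t. Re (g t)) has_real_derivative Re (g' t)) (at t within {0..1})"
      "((\<lambda>t. Im (g t)) has_real_derivative Im (g' t)) (at t within {0..1})"
      unfolding has_real_derivative_iff_has_vector_derivative
      by (intro bounded_linear.has_vector_derivative[OF bounded_linear_Re]
          bounded_linear.has_vector_derivative[OF bounded_linear_Im] has_vector_derivative_at_within[OF der])+
    then show "((\<lambda>t. Re (g t) * Im (g t)) has_vector_derivative Re (g' t) * Im (g t) + Re (g t) * Im (g' t))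
        (at t within {0..1})"
      using DERIV_mult[OF d]
      by (simp add: has_real_derivative_iff_has_vector_derivative mult.commute)
  qed simp
  then have I0: "integral {0..1} (\<lambda>t. Re (g' t) * Im (g t) + Re (g t) * Im (g' t)) = 0"
    using closed by (simp add: integral_unique)
  then have parts: "integral {0..1} (\<lambda>t. Re (g t) * Im (g' t)) = - integral {0..1} (\<lambda>t. Re (g' t) * Im (g t))"
  proof -
    have "(\<lambda>t. Re (g' t) * Im (g t)) integrable_on {0..1}" "(\<lambda>t. Re (g t) * Im (g' t)) integrable_on {0..1}"
      by (intro integrable_continuous_real continuous_intros cont01)+
    note integral_add[OF this]
    then show ?thesis using I0 by linarith
  qed
  have "(\<lambda>t. cnj (g t) * g' t) integrable_on {0..1}"
    by (intro integrable_continuous_real continuous_intros cont01)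
  from integral_linear[OF this bounded_linear_Im]
  have "Im (integral {0..1} (\<lambda>t. cnj (g t) * g' t)) = 
      integral {0..1} (\<lambda>t. Re (g t) * Im (g' t) - Re (g' t) * Im (g t))"
    by (simp add: o_def mult.commute[of _ "Im (g _)"])
  also have "\<dots> = integral {0..1} (\<lambda>t. Re (g t) * Im (g' t)) - integral {0..1} (\<lambda>t. Re (g' t) * Im (g t))"
    by (intro integral_diff integrable_continuous_real continuous_intros cont01)
  finally show ?thesis using XY parts by simp
qed

section \<open>The argument principle on circles\<close>

text \<open>Dividing out the only possible zero \<open>z0\<close> leaves \<open>k\<close>, which is
  nonzero at \<open>z0\<close> as well because an injective holomorphic function has nonvanishing
  derivative. The logarithmic derivative of \<open>k\<close> contributes 0 by Cauchy, and 1 / (z -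
  z0) contributes the winding number around \<open>z0\<close>, which is 0 if \<open>z0\<close> lies
  outside the circle.\<close>

lemma log_derivative_circle_injective:
  assumes hol: "\<psi> holomorphic_on ball 0 1" and inj: "inj_on \<psi> (ball 0 1)"
    and r: "0 < r" "r < 1" and nz: "\<And>z. norm z = r \<Longrightarrow> \<psi> z \<noteq> 0"
  shows "((\<lambda>z. deriv \<psi> z / \<psi> z) has_contour_integral
           (2 * pi * \<i> * of_bool (\<exists>z. norm z < r \<and> \<psi> z = 0))) (circlepath 0 r)"
proof (cases "\<exists>z0\<in>ball 0 1. \<psi> z0 = 0")
  case True
  then obtain z0 where z0: "norm z0 < 1" "\<psi> z0 = 0" by auto
  define k where "k z = (if z = z0 then deriv \<psi> z0 else \<psi> z / (z - z0))" for z
  have k: "k holomorphic_on ball 0 1"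
  proof -
    have "k = (\<lambda>z. if z = z0 then deriv \<psi> z0 else (\<psi> z - \<psi> z0) / (z - z0))"
      by (auto simp: fun_eq_iff k_def z0(2))
    then show ?thesis using pole_lemma_open[OF hol open_ball, of z0] by simp
  qed
  have knz: "k z \<noteq> 0" if "z \<in> ball 0 1" for z
  proof (cases "z = z0")
    case True
    then show ?thesis
      using holomorphic_injective_imp_regular[OF hol open_ball inj] that by (simp add: k_def)
  next
    case False
    then have "\<psi> z \<noteq> \<psi> z0" using inj_on_eq_iff[OF inj that] z0(1) by auto
    then show ?thesis using False z0(2) by (simp add: k_def)
  qed
  have "(\<lambda>z. deriv k z / k z) holomorphic_on ball 0 1"
    by (intro holomorphic_intros k holomorphic_deriv knz open_ball)
  then have "((\<lambda>z. deriv k z / k z) has_contour_integral 0) (circlepath 0 r)"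
    by (rule Cauchy_theorem_convex_simple) (use r in auto)
  moreover have "z0 \<notin> path_image (circlepath 0 r)"
    using r nz[of z0] z0 by auto
  then have "((\<lambda>z. 1 / (z - z0)) has_contour_integral (2 * pi * \<i> * winding_number (circlepath 0 r) z0)) (circlepath 0 r)"
    by (intro has_contour_integral_winding_number) auto
  ultimately have "((\<lambda>z. deriv k z / k z + 1 / (z - z0)) has_contour_integral
      (0 + 2 * pi * \<i> * winding_number (circlepath 0 r) z0)) (circlepath 0 r)"
    by (rule has_contour_integral_add)
  moreover have "deriv k z / k z + 1 / (z - z0) = deriv \<psi> z / \<psi> z" if "z \<in> path_image (circlepath 0 r)" for z
  proof -
    have z: "z \<in> ball 0 1" "z \<noteq> z0" "\<psi> z \<noteq> 0" using that r nz z0 by auto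
    have "(\<psi> has_field_derivative deriv \<psi> z) (at z)"
      using z hol holomorphic_derivI open_ball by blast
    then have "((\<lambda>z. \<psi> z / (z - z0)) has_field_derivative (deriv \<psi> z * (z - z0) - \<psi> z) / (z - z0)^2) (at z)"
      using z by (auto intro!: derivative_eq_intros simp: power2_eq_square)
    then have "(k has_field_derivative (deriv \<psi> z * (z - z0) - \<psi> z) / (z - z0)^2) (at z)"
      by (rule has_field_derivative_transform_within_open[where S = "- {z0}"]) (use z in \<open>auto simp: k_def\<close>)
    then have "deriv k z = (deriv \<psi> z * (z - z0) - \<psi> z) / (z - z0)^2" by (rule DERIV_imp_deriv)
    then show ?thesis using z by (simp add: k_def divide_simps) (simp add: algebra_simps power2_eq_square)
  qed
  ultimately have "((\<lambda>z. deriv \<psi> z / \<psi> z) has_contour_integral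
      (2 * pi * \<i> * winding_number (circlepath 0 r) z0)) (circlepath 0 r)"
    unfolding add_0 by (rule has_contour_integral_eq)
  moreover have "winding_number (circlepath 0 r) z0 = of_bool (\<exists>z. norm z < r \<and> \<psi> z = 0)"
  proof (cases "norm z0 < r")
    case True
    then show ?thesis using z0 by (auto intro!: winding_number_circlepath)
  next
    case False
    then have "winding_number (circlepath 0 r) z0 = 0"
      by (intro winding_number_zero_outside[of _ "cball 0 r"]) (use r nz[of z0] z0 in auto)
    moreover have "z = z0" if "norm z < r" "\<psi> z = 0" for z
      using inj_onD[OF inj, of z z0] that z0 r by auto
    ultimately show ?thesis using False by auto
  qed
  ultimately show ?thesis by simp
next
  case False
  then have "(\<lambda>z. deriv \<psi> z / \<psi> z) holomorphic_on ball 0 1"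
    by (intro holomorphic_intros hol holomorphic_deriv) auto
  then have "((\<lambda>z. deriv \<psi> z / \<psi> z) has_contour_integral 0) (circlepath 0 r)"
    by (rule Cauchy_theorem_convex_simple) (use r in auto)
  moreover have "(\<exists>z. norm z < r \<and> \<psi> z = 0) = False" using False r by auto
  ultimately show ?thesis by (simp only: of_bool_eq mult_zero_right)
qed

text \<open>Factor 1/\<Phi> - \<beta> = -\<beta> (\<Phi> - 1/\<beta>) / \<Phi>. The zero of \<Phi>
  at 0 contributes -1, and the injective function \<Phi> - 1/\<beta> contributes 0 or 1. For \<beta>
  = 0 only the -1 remains.\<close>

lemma log_derivative_circle_reciprocal:
  assumes hol: "\<Phi> holomorphic_on ball 0 1" and inj: "inj_on \<Phi> (ball 0 1)" and 0: "\<Phi> 0 = 0"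
    and r: "0 < r" "r < 1" and nz: "\<And>z. norm z = r \<Longrightarrow> 1 / \<Phi> z \<noteq> \<beta>"
  shows "\<exists>n::real. n \<le> 0 \<and> ((\<lambda>z. - deriv \<Phi> z / (\<Phi> z)\<^sup>2 / (1 / \<Phi> z - \<beta>)) has_contour_integral
           (2 * pi * \<i> * n)) (circlepath 0 r)"
proof -
  have nz0: "\<Phi> z \<noteq> 0" if "norm z = r" for z
    using inj_onD[OF inj, of z 0] that 0 r by auto
  have "((\<lambda>z. deriv \<Phi> z / \<Phi> z) has_contour_integral
           (2 * pi * \<i> * of_bool (\<exists>z. norm z < r \<and> \<Phi> z = 0))) (circlepath 0 r)"
    by (rule log_derivative_circle_injective[OF hol inj r nz0])
  moreover have "(\<exists>z. norm z < r \<and> \<Phi> z = 0)" using 0 r by (intro exI[of _ 0]) auto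
  ultimately have I0: "((\<lambda>z. deriv \<Phi> z / \<Phi> z) has_contour_integral (2 * pi * \<i>)) (circlepath 0 r)"
    by simp
  show ?thesis
  proof (cases "\<beta> = 0")
    case True
    have "((\<lambda>z. - deriv \<Phi> z / (\<Phi> z)\<^sup>2 / (1 / \<Phi> z - \<beta>)) has_contour_integral - (2 * pi * \<i>)) (circlepath 0 r)"
    proof (rule has_contour_integral_eq[OF has_contour_integral_neg[OF I0]])
      fix z assume "z \<in> path_image (circlepath 0 r)"
      then have "\<Phi> z \<noteq> 0" using r nz0 by auto
      then show "- (deriv \<Phi> z / \<Phi> z) = - deriv \<Phi> z / (\<Phi> z)\<^sup>2 / (1 / \<Phi> z - \<beta>)"
        by (simp add: True power2_eq_square)
    qed
    then show ?thesis by (intro exI[of _ "-1"]) auto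
  next
    case False
    define \<psi> where "\<psi> z = \<Phi> z - 1 / \<beta>" for z
    have \<psi>: "\<psi> holomorphic_on ball 0 1" "inj_on \<psi> (ball 0 1)"
      unfolding \<psi>_def using inj by (auto intro!: holomorphic_intros hol simp: inj_on_def)
    have \<psi>nz: "\<psi> z \<noteq> 0" if "norm z = r" for z
      using nz[OF that] nz0[OF that] False by (auto simp: \<psi>_def)
    define n :: real where "n = of_bool (\<exists>z. norm z < r \<and> \<psi> z = 0) - 1"
    have "((\<lambda>z. deriv \<psi> z / \<psi> z - deriv \<Phi> z / \<Phi> z) has_contour_integral
       (2 * pi * \<i> * of_bool (\<exists>z. norm z < r \<and> \<psi> z = 0) - 2 * pi * \<i>)) (circlepath 0 r)"
      by (intro has_contour_integral_diff I0 log_derivative_circle_injective \<psi> r \<psi>nz)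
    moreover have "2 * pi * \<i> * of_bool (\<exists>z. norm z < r \<and> \<psi> z = 0) - 2 * pi * \<i> = 2 * pi * \<i> * n"
      by (simp add: n_def algebra_simps)
    moreover have "deriv \<psi> z / \<psi> z - deriv \<Phi> z / \<Phi> z = - deriv \<Phi> z / (\<Phi> z)\<^sup>2 / (1 / \<Phi> z - \<beta>)"
      if "z \<in> path_image (circlepath 0 r)" for z
    proof -
      have z: "z \<in> ball 0 1" "norm z = r" using that r by auto
      have "(\<Phi> has_field_derivative deriv \<Phi> z) (at z)"
        using z(1) hol holomorphic_derivI open_ball by blast
      then have "deriv \<psi> z = deriv \<Phi> z"
        unfolding \<psi>_def by (intro DERIV_imp_deriv) (auto intro!: derivative_eq_intros)
      moreover have "\<Phi> z - 1 / \<beta> \<noteq> 0" "1 / \<Phi> z - \<beta> \<noteq> 0" "\<Phi> z \<noteq> 0" "\<Phi> z * \<beta> \<noteq> 1"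
        using \<psi>nz nz nz0 z False by (auto simp: \<psi>_def field_simps)
      ultimately show ?thesis using False
        by (simp add: \<psi>_def divide_simps) (simp add: algebra_simps power2_eq_square)
    qed
    ultimately have "((\<lambda>z. - deriv \<Phi> z / (\<Phi> z)\<^sup>2 / (1 / \<Phi> z - \<beta>)) has_contour_integral (2 * pi * \<i> * n)) (circlepath 0 r)"
      by (simp only: has_contour_integral_eq)
    then show ?thesis by (intro exI[of _ n]) (auto simp: n_def)
  qed
qed

text \<open>Logarithmic derivatives add under multiplication, so induction on the degree splits off
  one linear factor at a time. The count \<open>n\<close> is recorded as a real number with its
  sign, the information that enters the area bound.\<close>

lemma log_derivative_circle_poly:
  assumes hol: "\<Phi> holomorphic_on ball 0 1" and inj: "inj_on \<Phi> (ball 0 1)" and 0: "\<Phi> 0 = 0"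
    and r: "0 < r" "r < 1" and nz: "\<And>z. norm z = r \<Longrightarrow> poly P (1 / \<Phi> z) \<noteq> 0"
  shows "\<exists>n::real. n \<le> 0 \<and> ((\<lambda>z. poly (pderiv P) (1 / \<Phi> z) * (- deriv \<Phi> z / (\<Phi> z)\<^sup>2) / poly P (1 / \<Phi> z))
      has_contour_integral (2 * pi * \<i> * n)) (circlepath 0 r)"
  using nz
proof (induction "degree P" arbitrary: P)
  case 0
  then obtain c where "P = [:c:]" by (metis degree_0_id)
  then show ?case by (intro exI[of _ 0]) (auto simp: pderiv_pCons intro: has_contour_integral_0)
next
  case (Suc d)
  then have "\<not> constant (poly P)" by (simp add: constant_degree)
  then obtain \<beta> where "poly P \<beta> = 0" using fundamental_theorem_of_algebra by blast
  then obtain Q where P: "P = [:-\<beta>, 1:] * Q" by (auto simp: poly_eq_0_iff_dvd)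
  have "Q \<noteq> 0" using P Suc.hyps by auto
  then have "d = degree Q" using Suc.hyps unfolding P by (subst (asm) degree_mult_eq) auto
  have nzQ: "poly Q (1 / \<Phi> z) \<noteq> 0" and nz\<beta>: "1 / \<Phi> z \<noteq> \<beta>" if "norm z = r" for z
    using Suc.prems[OF that] by (auto simp: P)
  obtain n where n: "n \<le> 0" "((\<lambda>z. poly (pderiv Q) (1 / \<Phi> z) * (- deriv \<Phi> z / (\<Phi> z)\<^sup>2) / poly Q (1 / \<Phi> z))
      has_contour_integral (2 * pi * \<i> * of_real n)) (circlepath 0 r)"
    using Suc.hyps(1)[OF \<open>d = degree Q\<close> nzQ] by blast
  obtain m where m: "m \<le> 0" "((\<lambda>z. - deriv \<Phi> z / (\<Phi> z)\<^sup>2 / (1 / \<Phi> z - \<beta>)) has_contour_integral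
           (2 * pi * \<i> * of_real m)) (circlepath 0 r)"
    using log_derivative_circle_reciprocal[OF hol inj 0 r nz\<beta>] by blast
  have "((\<lambda>z. poly (pderiv P) (1 / \<Phi> z) * (- deriv \<Phi> z / (\<Phi> z)\<^sup>2) / poly P (1 / \<Phi> z))
      has_contour_integral (2 * pi * \<i> * of_real n + 2 * pi * \<i> * of_real m)) (circlepath 0 r)"
  proof (rule has_contour_integral_eq[OF has_contour_integral_add[OF n(2) m(2)]])
    fix z assume "z \<in> path_image (circlepath 0 r)"
    then have z: "norm z = r" using r by auto
    have "1 / \<Phi> z - \<beta> \<noteq> 0" using nz\<beta>[OF z] by simp
    have polyP: "poly P w = (w - \<beta>) * poly Q w"
      "poly (pderiv P) w = (w - \<beta>) * poly (pderiv Q) w + poly Q w" for w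
      unfolding P pderiv_mult by (simp_all add: pderiv_pCons del: mult_pCons_left)
    \<comment> \<open>Here \<open>b\<close> and \<open>q\<close> stand for the values of the linear
      factor and of \<open>Q\<close> at 1/\<Phi>, \<open>q'\<close> for that of the derivative of
      \<open>Q\<close>, and \<open>e\<close> for the derivative of 1/\<Phi>.\<close>
    have alg: "q' * e / q + e / b = (b * q' + q) * e / (b * q)" if "q \<noteq> 0" "b \<noteq> 0" for q' e q b :: complex
      using that by (simp add: field_simps)
    show "poly (pderiv Q) (1 / \<Phi> z) * (- deriv \<Phi> z / (\<Phi> z)\<^sup>2) / poly Q (1 / \<Phi> z) 
        + - deriv \<Phi> z / (\<Phi> z)\<^sup>2 / (1 / \<Phi> z - \<beta>) =
       poly (pderiv P) (1 / \<Phi> z) * (- deriv \<Phi> z / (\<Phi> z)\<^sup>2) / poly P (1 / \<Phi> z)"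
      unfolding alg[OF nzQ[OF z] \<open>1 / \<Phi> z - \<beta> \<noteq> 0\<close>]
      by (simp only: polyP)
  qed
  then show ?case using n m by (intro exI[of _ "n + m"]) (auto simp: distrib_left)
qed

section \<open>Parseval's identity on circles\<close>

text \<open>On the circle the conjugate of z is r^2 / z, so the integrand equals r^(2n) f(z) / z^n;
  with dz = 2 pi i z dt this is Cauchy's formula for the n-th derivative at 0.\<close>

lemma circle_coefficient:
  assumes hol: "f holomorphic_on ball 0 1" and F: "f has_fps_expansion F" and r: "0 < r" "r < 1"
  shows "integral {0..1} (\<lambda>t. f (circlepath 0 r t) * cnj (circlepath 0 r t) ^ n) = fps_nth F n * of_real (r ^ (2 * n))"
proof -
  let ?z = "circlepath 0 r"
  have nz: "?z t \<noteq> 0" for t using r by (simp add: circlepath)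
  have zz: "?z t * cnj (?z t) = of_real (r\<^sup>2)" for t
    using r by (simp only: complex_norm_square[symmetric]) (simp add: circlepath norm_mult)
  have "((\<lambda>u. f u / (u - 0) ^ Suc n) has_contour_integral (2 * pi * \<i> / fact n * (deriv ^^ n) f 0)) ?z"
    by (rule Cauchy_has_contour_integral_higher_derivative_circlepath)
       (use r in \<open>auto intro!: holomorphic_on_imp_continuous_on holomorphic_on_subset[OF hol]\<close>)
  then have "integral {0..1} (\<lambda>t. f (?z t) / ?z t ^ Suc n * vector_derivative ?z (at t)) = 2 * pi * \<i> * fps_nth F n"
    using contour_integral_unique by (fastforce simp: contour_integral_integral fps_nth_fps_expansion[OF F])
  moreover have "f (?z t) / ?z t ^ Suc n * vector_derivative ?z (at t) = 
      (2 * pi * \<i> / r ^ (2 * n)) * (f (?z t) * cnj (?z t) ^ n)" for t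
  proof -
    have "vector_derivative ?z (at t) = 2 * pi * \<i> * ?z t"
      unfolding vector_derivative_circlepath by (simp add: circlepath)
    moreover have "cnj (?z t) = of_real (r\<^sup>2) / ?z t"
      using zz[of t] nz[of t] by (simp add: field_simps)
    ultimately show ?thesis using nz[of t] r
      by (simp add: power_divide power_mult)
  qed
  ultimately have "integral {0..1} (\<lambda>t. (2 * pi * \<i> / r ^ (2 * n)) * (f (?z t) * cnj (?z t) ^ n)) = 2 * pi * \<i> * fps_nth F n"
    by (simp only:)
  then have "(2 * pi * \<i> / r ^ (2 * n)) * integral {0..1} (\<lambda>t. f (?z t) * cnj (?z t) ^ n) = 2 * pi * \<i> * fps_nth F n"
    by (simp only: integral_mult_right)
  then show ?thesis using r by (simp add: field_simps)
qed

text \<open>Only \<open>g\<close> is expanded: its series converges uniformly on the circle, so it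
  may be integrated termwise, and \<open>circle_coefficient\<close> applied to \<open>f\<close>
  turns each term into a product of coefficients.\<close>

lemma circle_Parseval:
  assumes f: "f holomorphic_on ball 0 1" "f has_fps_expansion F"
    and g: "g holomorphic_on ball 0 1" "g has_fps_expansion G" and r: "0 < r" "r < 1"
  shows "(\<lambda>n. cnj (fps_nth F n) * fps_nth G n * of_real (r ^ (2 * n))) sums
           integral {0..1} (\<lambda>t. cnj (f (circlepath 0 r t)) * g (circlepath 0 r t))"
proof -
  let ?z = "circlepath 0 r"
  define u where "u n t = cnj (f (?z t)) * (fps_nth G n * ?z t ^ n)" for n t
  have z: "?z t \<in> ball 0 1" "norm (?z t) = r" for t using r by (auto simp: circlepath norm_mult)
  have cz: "continuous_on {0..1} ?z"
    unfolding circlepath by (intro continuous_intros)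
  have cf: "continuous_on {0..1} (\<lambda>t. f (?z t))" 
    using f by (intro continuous_on_compose2[OF holomorphic_on_imp_continuous_on cz]) (use z in auto)
  have "compact ((\<lambda>t. f (?z t)) ` {0..1})"
    by (intro compact_continuous_image cf) auto
  then obtain K where K: "\<And>t. t \<in> {0..1} \<Longrightarrow> norm (f (?z t)) \<le> K"
    by (meson compact_imp_bounded bounded_iff imageI)
  have Gs: "(\<lambda>n. fps_nth G n * w ^ n) sums g w" if "w \<in> ball 0 1" for w
    using holomorphic_power_series[OF g(1) that] by (simp add: fps_nth_fps_expansion[OF g(2)])
  have "summable (\<lambda>n. norm (fps_nth G n * of_real r ^ n))"
  proof -
    \<comment> \<open>A radius strictly between r and 1: convergence at \<open>\<rho>\<close> forces
      absolute convergence at \<open>r\<close>.\<close>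
    define \<rho> where "\<rho> = (1 + r) / 2"
    have \<rho>: "r < \<rho>" "\<rho> < 1" using r by (auto simp: \<rho>_def)
    then show ?thesis
      using r by (intro powser_insidea[OF sums_summable[OF Gs[of "of_real \<rho>"]]]) auto
  qed
  then have sm: "summable (\<lambda>n. K * norm (fps_nth G n * of_real r ^ n))"
    by (rule summable_mult)
  have "uniform_limit {0..1} (\<lambda>N t. \<Sum>n<N. u n t) (\<lambda>t. \<Sum>n. u n t) sequentially"
  proof (rule Weierstrass_m_test[OF _ sm])
    fix n and t :: real assume "t \<in> {0..1}"
    then show "norm (u n t) \<le> K * norm (fps_nth G n * of_real r ^ n)"
      unfolding u_def norm_mult complex_mod_cnj norm_power z(2) using K r
      by (simp add: mult_right_mono)
  qed
  moreover have "(\<Sum>n. u n t) = cnj (f (?z t)) * g (?z t)" for t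
    using sums_unique[OF sums_mult[OF Gs[OF z(1)]]] by (simp add: u_def)
  ultimately have ul: "uniform_limit {0..1} (\<lambda>N t. \<Sum>n<N. u n t) (\<lambda>t. cnj (f (?z t)) * g (?z t)) sequentially"
    by simp
  have cu: "continuous_on {0..1} (u n)" for n
    unfolding u_def by (intro continuous_intros cf cz)
  have int_u: "integral {0..1} (u n) = cnj (fps_nth F n) * fps_nth G n * of_real (r ^ (2 * n))" for n
  proof -
    have "integral {0..1} (u n) = fps_nth G n * integral {0..1} (\<lambda>t. cnj (f (?z t) * cnj (?z t) ^ n))"
      by (simp add: u_def[abs_def] mult.left_commute)
    also have "\<dots> = fps_nth G n * cnj (fps_nth F n * of_real (r ^ (2 * n)))"
      by (simp only: Henstock_Kurzweil_Integration.integral_cnj[symmetric] circle_coefficient[OF f r])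
    finally show ?thesis by (simp add: mult_ac)
  qed
  obtain I J where I: "\<And>N. ((\<lambda>t. \<Sum>n<N. u n t) has_integral I N) {0..1}"
    and J: "((\<lambda>t. cnj (f (?z t)) * g (?z t)) has_integral J) {0..1}" and lim: "I \<longlonglongrightarrow> J"
    by (rule uniform_limit_integral[OF ul]) (auto intro!: continuous_intros cu)
  have "I N = (\<Sum>n<N. cnj (fps_nth F n) * fps_nth G n * of_real (r ^ (2 * n)))" for N
    using integral_unique[OF I[of N]] by (simp add: integral_sum int_u integrable_continuous_real cu)
  then have "I = (\<lambda>N. \<Sum>n<N. cnj (fps_nth F n) * fps_nth G n * of_real (r ^ (2 * n)))" ..
  with lim show ?thesis unfolding sums_def integral_unique[OF J] by (simp only:)
qed

section \<open>The area theorem for polynomials in 1/\<Phi>\<close>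

text \<open>The factor z^m clears the pole of Q(1/\<Phi>), so \<open>fps_nth F n\<close> is its
  Laurent coefficient of index n - m, and the weight is that index. For each r < 1 the image of the
  circle has nonpositive signed area, which Parseval writes as a weighted sum of squares; then r
  tends to 1.\<close>

lemma area_inequality:
  fixes \<Phi> A :: "complex \<Rightarrow> complex" and Q :: "complex poly"
  assumes hol: "\<Phi> holomorphic_on ball 0 1" and inj: "inj_on \<Phi> (ball 0 1)" and 0: "\<Phi> 0 = 0"
    and A: "A holomorphic_on ball 0 1" "A has_fps_expansion F"
    and eq: "\<And>z. z \<in> ball 0 1 - {0} \<Longrightarrow> A z = z ^ m * poly Q (1 / \<Phi> z)" and "m \<le> N"
  shows "(\<Sum>n\<le>N. (real n - real m) * (norm (fps_nth F n))\<^sup>2) \<le> 0"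
proof -
  have \<Phi>nz: "\<Phi> z \<noteq> 0" if "z \<in> ball 0 1 - {0}" for z
    using inj_onD[OF inj, of z 0] that 0 by auto
  define D where "D w = poly (pderiv Q) (1 / \<Phi> w) * (- deriv \<Phi> w / (\<Phi> w)\<^sup>2)" for w
  \<comment> \<open>Off 0 this is z^(m+1) times the derivative of Q(1/\<Phi>), and its n-th
    coefficient is n - m times that of \<open>A\<close>.\<close>
  define B where "B w = w * deriv A w - of_nat m * A w" for w
  have B: "B holomorphic_on ball 0 1"
    unfolding B_def by (intro holomorphic_intros A holomorphic_deriv) auto
  have FB: "B has_fps_expansion (fps_X * fps_deriv F - fps_const (of_nat m) * F)"
    unfolding B_def by (intro fps_expansion_intros A)
  have der: "((\<lambda>w. poly Q (1 / \<Phi> w)) has_field_derivative D w) (at w)" if "w \<in> ball 0 1 - {0}" for w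
  proof -
    have "(\<Phi> has_field_derivative deriv \<Phi> w) (at w)"
      using that hol holomorphic_derivI open_ball by blast
    then have "((\<lambda>w. 1 / \<Phi> w) has_field_derivative - deriv \<Phi> w / (\<Phi> w)\<^sup>2) (at w)"
      using \<Phi>nz[OF that] by (auto intro!: derivative_eq_intros simp: power2_eq_square)
    from DERIV_chain2[OF poly_DERIV this] show ?thesis by (simp add: D_def)
  qed
  have DB: "w ^ m * (w * D w) = B w" if w: "w \<in> ball 0 1 - {0}" for w
  proof -
    have "((\<lambda>w. w ^ m * poly Q (1 / \<Phi> w)) has_field_derivative 
        of_nat m * w ^ (m - 1) * poly Q (1 / \<Phi> w) + w ^ m * D w) (at w)"
    proof -
      have "((\<lambda>w. w ^ m) has_field_derivative of_nat m * w ^ (m - 1)) (at w)"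
        by (auto intro!: derivative_eq_intros)
      from DERIV_mult[OF this der[OF w]] show ?thesis by (simp add: mult.commute)
    qed
    then have "(A has_field_derivative of_nat m * w ^ (m - 1) * poly Q (1 / \<Phi> w) + w ^ m * D w) (at w)"
      by (rule has_field_derivative_transform_within_open[where S = "ball 0 1 - {0}"])
         (use w eq in auto)
    then have "deriv A w = of_nat m * w ^ (m - 1) * poly Q (1 / \<Phi> w) + w ^ m * D w"
      by (rule DERIV_imp_deriv)
    then show ?thesis
      \<comment> \<open>The exponent m - 1 is truncated: for m = 0 its term carries the factor 0,
        otherwise the extra w restores w^m.\<close>
      by (cases m) (simp_all add: B_def eq[OF w] algebra_simps)
  qed
  have contD: "continuous_on (ball 0 1 - {0}) D"
    unfolding D_def using \<Phi>nz
    by (intro continuous_intros holomorphic_on_imp_continuous_on holomorphic_on_subset[OF hol]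
         holomorphic_on_subset[OF holomorphic_deriv[OF hol open_ball]]) auto
  have le: "(\<Sum>n\<le>N. (real n - real m) * (norm (fps_nth F n))\<^sup>2 * r ^ (2 * n)) \<le> 0"
    if r: "0 < r" "r < 1" for r
  proof -
    let ?z = "circlepath 0 r"
    have z: "?z t \<in> ball 0 1 - {0}" "norm (?z t) = r" for t using r by (auto simp: circlepath norm_mult)
    have dz: "(?z has_vector_derivative 2 * pi * \<i> * ?z t) (at t)" for t
    proof -
      have "2 * pi * \<i> * ?z t = 2 * pi * \<i> * r * exp (2 * of_real pi * \<i> * t)" by (simp add: circlepath)
      then show ?thesis using has_vector_derivative_circlepath[of 0 r t UNIV] by (simp only:)
    qed
    have cz: "continuous_on UNIV ?z"
      unfolding circlepath by (intro continuous_intros)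
    define g where "g t = poly Q (1 / \<Phi> (?z t))" for t
    define g' where "g' t = 2 * pi * \<i> * ?z t * D (?z t)" for t
    have dg: "(g has_vector_derivative g' t) (at t)" for t
      using field_vector_diff_chain_at[OF dz der[OF z(1)], of t] by (simp add: g_def[abs_def] g'_def o_def)
    have cg': "continuous_on UNIV g'"
      unfolding g'_def
      by (intro continuous_intros cz continuous_on_compose2[OF contD cz]) (use z(1) in auto)
    have vp: "valid_path g"
      unfolding valid_path_def
      by (rule C1_differentiable_imp_piecewise)
         (use dg continuous_on_subset[OF cg'] in \<open>auto simp: C1_differentiable_on_def\<close>)
    have "Im (integral {0..1} (\<lambda>t. cnj (g t) * g' t)) \<le> 0"
    proof (rule signed_area_nonpos[OF dg cg'])
      show "g 1 = g 0"
        by (simp add: g_def circlepath)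
      fix a assume a: "a \<notin> path_image g"
      define P where "P = Q - [:a:]"
      have nz: "poly P (1 / \<Phi> z) \<noteq> 0" if "norm z = r" for z
      proof -
        have "z \<in> path_image ?z" using that r by auto
        then show ?thesis using a by (auto simp: path_image_def g_def P_def image_iff)
      qed
      obtain n :: real where n: "n \<le> 0" "((\<lambda>z. poly (pderiv P) (1 / \<Phi> z) * (- deriv \<Phi> z / (\<Phi> z)\<^sup>2) / poly P (1 / \<Phi> z))
          has_contour_integral (2 * pi * \<i> * n)) ?z"
        using log_derivative_circle_poly[OF hol inj 0 r nz] by blast
      \<comment> \<open>The substitution w = Q(1/\<Phi>(z)) turns dw / (w - a) into the logarithmic
        derivative of P = Q - a along the circle.\<close>
      have "contour_integral g (\<lambda>w. 1 / (w - a)) = 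
          contour_integral ?z (\<lambda>z. poly (pderiv P) (1 / \<Phi> z) * (- deriv \<Phi> z / (\<Phi> z)\<^sup>2) / poly P (1 / \<Phi> z))"
        unfolding contour_integral_integral vector_derivative_at[OF dg] vector_derivative_at[OF dz]
        by (simp add: g_def g'_def D_def P_def pderiv_diff pderiv_pCons mult_ac)
      also have "\<dots> = 2 * pi * \<i> * n"
        using n(2) by (rule contour_integral_unique)
      finally have "winding_number g a = n"
        using a by (subst winding_number_valid_path[OF vp]) auto
      then show "Re (winding_number g a) \<le> 0" using n(1) by simp
    qed
    \<comment> \<open>On the circle |z|^(2m) = r^(2m) is constant, so the powers z^m in
      \<open>A\<close> and \<open>B\<close> only rescale the area integral, which becomes one for
      two power series.\<close>
    also have "integral {0..1} (\<lambda>t. cnj (g t) * g' t) = 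
        integral {0..1} (\<lambda>t. (2 * pi * \<i> / r ^ (2 * m)) * (cnj (A (?z t)) * B (?z t)))"
    proof (rule integral_cong)
      fix t
      have "?z t * cnj (?z t) = of_real (r\<^sup>2)"
        using z(2)[of t] by (simp only: complex_norm_square[symmetric])
      then have "cnj (?z t) ^ m * ?z t ^ m = of_real (r\<^sup>2) ^ m"
        by (metis mult.commute power_mult_distrib)
      then have "cnj (?z t) ^ m * ?z t ^ m = of_real (r ^ (2 * m))"
        by (simp only: power_mult of_real_power)
      moreover have "cnj (A (?z t)) * B (?z t) = (cnj (?z t) ^ m * ?z t ^ m) * (cnj (g t) * (?z t * D (?z t)))"
        unfolding DB[OF z(1), symmetric] eq[OF z(1)] by (simp add: g_def)
      ultimately show "cnj (g t) * g' t = (2 * pi * \<i> / r ^ (2 * m)) * (cnj (A (?z t)) * B (?z t))"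
        using r by (simp add: g'_def)
    qed
    also have "\<dots> = (2 * pi * \<i> / r ^ (2 * m)) * integral {0..1} (\<lambda>t. cnj (A (?z t)) * B (?z t))"
      by simp
    also have "Im \<dots> = 2 * pi / r ^ (2 * m) * Re (integral {0..1} (\<lambda>t. cnj (A (?z t)) * B (?z t)))"
      by (simp flip: of_real_power)
    finally have "2 * pi / r ^ (2 * m) * Re (integral {0..1} (\<lambda>t. cnj (A (?z t)) * B (?z t))) \<le> 0" .
    moreover have "2 * pi / r ^ (2 * m) > 0" using r by simp
    ultimately have neg: "Re (integral {0..1} (\<lambda>t. cnj (A (?z t)) * B (?z t))) \<le> 0"
      by (meson mult_le_0_iff not_le)
    have "(\<lambda>n. Re (cnj (fps_nth F n) * fps_nth (fps_X * fps_deriv F - fps_const (of_nat m) * F) n * of_real (r ^ (2 * n))))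
       sums Re (integral {0..1} (\<lambda>t. cnj (A (?z t)) * B (?z t)))"
      by (intro sums_Re circle_Parseval A B FB r)
    moreover have "Re (cnj (fps_nth F n) * fps_nth (fps_X * fps_deriv F - fps_const (of_nat m) * F) n * of_real (r ^ (2 * n))) = 
        (real n - real m) * (norm (fps_nth F n))\<^sup>2 * r ^ (2 * n)" for n
    proof -
      have "fps_nth (fps_X * fps_deriv F - fps_const (of_nat m) * F) n = of_real (real n - real m) * fps_nth F n"
        by (cases n) (simp_all add: algebra_simps)
      then have "cnj (fps_nth F n) * fps_nth (fps_X * fps_deriv F - fps_const (of_nat m) * F) n * of_real (r ^ (2 * n))
         = of_real ((real n - real m) * r ^ (2 * n)) * (fps_nth F n * cnj (fps_nth F n))"
        by simp
      then show ?thesis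
        by (simp only: complex_norm_square[symmetric]) simp
    qed
    ultimately have s: "(\<lambda>n. (real n - real m) * (norm (fps_nth F n))\<^sup>2 * r ^ (2 * n)) sums
       Re (integral {0..1} (\<lambda>t. cnj (A (?z t)) * B (?z t)))" by (simp only:)
    \<comment> \<open>Terms with n > N have nonnegative weight because m <= N, so truncation only
      lowers the sum.\<close>
    have "(\<Sum>n\<le>N. (real n - real m) * (norm (fps_nth F n))\<^sup>2 * r ^ (2 * n)) \<le> 
       (\<Sum>n. (real n - real m) * (norm (fps_nth F n))\<^sup>2 * r ^ (2 * n))"
      using \<open>m \<le> N\<close> r by (intro sum_le_suminf sums_summable[OF s]) auto
    then show ?thesis using neg sums_unique[OF s] by simp
  qed
  have "((\<lambda>r. \<Sum>n\<le>N. (real n - real m) * (norm (fps_nth F n))\<^sup>2 * r ^ (2 * n)) \<longlongrightarrow> 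
     (\<Sum>n\<le>N. (real n - real m) * (norm (fps_nth F n))\<^sup>2 * 1 ^ (2 * n))) (at_left 1)"
    by (intro tendsto_intros)
  moreover have "\<forall>\<^sub>F r in at_left 1. (\<Sum>n\<le>N. (real n - real m) * (norm (fps_nth F n))\<^sup>2 * r ^ (2 * n)) \<le> 0"
    using eventually_at_left_real[of 0 "1::real"] by (auto elim!: eventually_mono intro: le)
  ultimately show ?thesis
    using tendsto_upperbound[of _ _ "at_left (1::real)" 0] by (simp add: trivial_limit_at_left_real)
qed

section \<open>Two area inequalities for the logarithmic coefficients\<close>

lemma fps_exp_compose_nth:
  fixes G :: "complex fps"
  assumes "fps_nth G 0 = 0"
  shows "fps_nth (fps_exp c oo G) 0 = 1"
    and "fps_nth (fps_exp c oo G) (Suc 0) = c * fps_nth G 1"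
    and "fps_nth (fps_exp c oo G) 2 = c * fps_nth G 2 + c\<^sup>2 * (fps_nth G 1)\<^sup>2 / 2"
    and "fps_nth (fps_exp c oo G) 3 = c * fps_nth G 3 + c\<^sup>2 * fps_nth G 1 * fps_nth G 2 + c ^ 3 * (fps_nth G 1) ^ 3 / 6"
  using assms
  by (simp_all add: fps_compose_nth fps_mult_nth eval_nat_numeral field_simps)

lemma fps_compose_X_square_nth:
  fixes E :: "complex fps"
  shows "fps_nth (E oo fps_X\<^sup>2) n = (if even n then fps_nth E (n div 2) else 0)"
proof -
  have "fps_nth (E oo fps_X\<^sup>2) n = (\<Sum>i=0..n. fps_nth E i * (if n = 2 * i then 1 else 0))"
    by (simp add: fps_compose_nth flip: power_mult)
  also have "\<dots> = (\<Sum>i\<in>{0..n} \<inter> {i. n = 2 * i}. fps_nth E i)"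
    by (subst sum.inter_restrict) (auto intro!: sum.cong)
  also have "{0..n} \<inter> {i. n = 2 * i} = (if even n then {n div 2} else {})" by auto
  finally show ?thesis by simp
qed

text \<open>The value \<open>\<gamma> 0\<close> is arbitrary, so the constant term is set to 0, in
  accordance with a sum starting at index 1.\<close>

lemma log_quotient_has_fps_expansion:
  fixes L :: "complex \<Rightarrow> complex" and \<gamma> :: "nat \<Rightarrow> complex"
  assumes "\<And>z. z \<in> ball 0 1 \<Longrightarrow> summable (\<lambda>n. \<gamma> (Suc n) * z ^ Suc n) \<and> L z = 2 * (\<Sum>n. \<gamma> (Suc n) * z ^ Suc n)"
  shows "L has_fps_expansion Abs_fps (\<lambda>n. if n = 0 then 0 else 2 * \<gamma> n)"
proof (rule has_fps_expansionI)
  have "(\<lambda>n. fps_nth (Abs_fps (\<lambda>n. if n = 0 then 0 else 2 * \<gamma> n)) n * u ^ n) sums L u" if "u \<in> ball 0 1" for u :: complex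
  proof -
    have "(\<lambda>n. \<gamma> (Suc n) * u ^ Suc n) sums (\<Sum>n. \<gamma> (Suc n) * u ^ Suc n)"
      using assms[OF that] by blast
    from sums_mult[OF this, of 2] have "(\<lambda>n. 2 * \<gamma> (Suc n) * u ^ Suc n) sums L u"
      using assms[OF that] by (simp add: mult.assoc)
    then show ?thesis
      using sums_Suc[of "\<lambda>n. fps_nth (Abs_fps (\<lambda>n. if n = 0 then 0 else 2 * \<gamma> n)) n * u ^ n" "L u"] by simp
  qed
  then show "\<forall>\<^sub>F u in nhds 0. (\<lambda>n. fps_nth (Abs_fps (\<lambda>n. if n = 0 then 0 else 2 * \<gamma> n)) n * u ^ n) sums L u"
    by (intro eventually_nhds_in_open[THEN eventually_mono, of "ball 0 1"]) auto
qed

lemma is_log_quotient_eq: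
  assumes "f \<in> class_S" "is_log_quotient f L" "z \<in> ball 0 1"
  shows "f z = z * exp (L z)"
  using assms by (auto simp: is_log_quotient_def quotient_id_def class_S_def)

text \<open>For \<Phi> = f and Q(w) = w, the function z / f(z) = exp(-L) has weights -1, 0, 1 at n =
  0, 1, 2, which leaves |F_2| <= |F_0| = 1. In Taylor coefficients this is the classical |a_3 -
  a_2^2| <= 1.\<close>

lemma log_coefficients_area_first:
  fixes f L :: "complex \<Rightarrow> complex" and \<gamma> :: "nat \<Rightarrow> complex"
  assumes f: "f \<in> class_S" and L: "is_log_quotient f L"
    and \<gamma>: "L has_fps_expansion Abs_fps (\<lambda>n. if n = 0 then 0 else 2 * \<gamma> n)"
  shows "norm (2 * (\<gamma> 2 - (\<gamma> 1)\<^sup>2)) \<le> 1"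
proof -
  let ?G = "Abs_fps (\<lambda>n. if n = 0 then 0 else 2 * \<gamma> n)"
  define F where "F = fps_exp (-1) oo ?G"
  have L': "L holomorphic_on ball 0 1" using L by (simp add: is_log_quotient_def)
  have "(\<Sum>n\<le>2. (real n - real 1) * (norm (fps_nth F n))\<^sup>2) \<le> 0"
  proof (rule area_inequality[where \<Phi> = f and A = "\<lambda>z. exp (-1 * L z)" and Q = "[:0, 1:]"])
    show "(\<lambda>z. exp (-1 * L z)) has_fps_expansion F"
      unfolding F_def using has_fps_expansion_compose[OF has_fps_expansion_exp[of "-1"] \<gamma>]
      by (simp add: o_def)
  qed (use f in \<open>auto simp: class_S_def is_log_quotient_eq[OF f L] exp_minus field_simps intro!: holomorphic_intros L'\<close>)
  moreover have "{..2::nat} = {0, 1, 2}" by auto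
  moreover have "fps_nth F 0 = 1" "fps_nth F 1 = - 2 * \<gamma> 1" "fps_nth F 2 = 2 * ((\<gamma> 1)\<^sup>2 - \<gamma> 2)"
    by (simp_all add: F_def fps_exp_compose_nth power2_eq_square algebra_simps)
  ultimately have "(norm (2 * ((\<gamma> 1)\<^sup>2 - \<gamma> 2)))\<^sup>2 \<le> 1\<^sup>2"
    by simp
  then have "norm (2 * ((\<gamma> 1)\<^sup>2 - \<gamma> 2)) \<le> 1" by (rule power2_le_imp_le) simp
  then show ?thesis by (simp only: norm_mult norm_minus_commute)
qed

text \<open>The function \<open>A\<close> is even, so only n = 0, 2, 4, 6 contribute, with weights
  -3, -1, 1, 3. The coefficients there are -1/3, -2 \<gamma>_1, \<gamma>_2 + (3/2) \<gamma>_1^2 and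
  \<gamma>_3; dividing the last two signs from the first two gives the inequality.\<close>

lemma log_coefficients_area_odd:
  fixes f L :: "complex \<Rightarrow> complex" and \<gamma> :: "nat \<Rightarrow> complex"
  assumes f: "f \<in> class_S" and L: "is_log_quotient f L"
    and \<gamma>: "L has_fps_expansion Abs_fps (\<lambda>n. if n = 0 then 0 else 2 * \<gamma> n)"
  shows "(norm (\<gamma> 2 + 3 / 2 * (\<gamma> 1)\<^sup>2))\<^sup>2 + 3 * (norm (\<gamma> 3))\<^sup>2 \<le> 4 * (norm (\<gamma> 1))\<^sup>2 + 1 / 3"
proof -
  let ?G = "Abs_fps (\<lambda>n. if n = 0 then 0 else 2 * \<gamma> n)"
  define E where "E c = (fps_exp c oo ?G) oo fps_X\<^sup>2" for c
  \<comment> \<open>The factor -1/3 makes \<gamma>_3 appear in the coefficient of z^6 with factor 1;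
    the choice -3 \<gamma>_1 then cancels both the \<gamma>_1 \<gamma>_2 and the \<gamma>_1^3 terms
    there.\<close>
  define F where "F = fps_const (-1/3) * E (-3/2) + fps_const (-3 * \<gamma> 1) * (fps_X\<^sup>2 * E (-1/2))"
  \<comment> \<open>A square root of f(z^2), given through \<open>L\<close> so that no branch has to
    be chosen.\<close>
  define \<Phi> where "\<Phi> z = z * exp (L (z\<^sup>2) / 2)" for z
  define A where "A z = -1/3 * exp (-3/2 * L (z\<^sup>2)) + -3 * \<gamma> 1 * (z\<^sup>2 * exp (-1/2 * L (z\<^sup>2)))" for z
  have sq: "z\<^sup>2 \<in> ball 0 1" if "z \<in> ball 0 1" for z :: complex
    using that by (simp add: norm_power power_less_one_iff)
  have L': "L holomorphic_on ball 0 1" using L by (simp add: is_log_quotient_def)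
  have "(L \<circ> (\<lambda>z. z\<^sup>2)) holomorphic_on ball 0 1"
    by (rule holomorphic_on_compose_gen[OF _ L']) (auto intro!: holomorphic_intros simp: sq[simplified])
  then have L2: "(\<lambda>z. L (z\<^sup>2)) holomorphic_on ball 0 1" by (simp add: o_def)
  have \<Phi>sq: "(\<Phi> z)\<^sup>2 = f (z\<^sup>2)" if "z \<in> ball 0 1" for z
    using is_log_quotient_eq[OF f L sq[OF that]] by (simp add: \<Phi>_def power_mult_distrib flip: exp_double)
  have inj: "inj_on \<Phi> (ball 0 1)"
  proof (rule inj_onI)
    fix z w assume zw: "z \<in> ball 0 1" "w \<in> ball 0 1" and eq: "\<Phi> z = \<Phi> w"
    have "inj_on f (ball 0 1)" using f by (simp add: class_S_def)
    then have "z\<^sup>2 = w\<^sup>2"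
      using \<Phi>sq[OF zw(1)] \<Phi>sq[OF zw(2)] eq sq zw by (metis inj_onD)
    then have "z = w \<or> z = - w" by (simp add: power2_eq_iff)
    \<comment> \<open>\<Phi> is odd and vanishes only at 0.\<close>
    moreover have "z = 0" if "z = - w" using eq that by (simp add: \<Phi>_def)
    ultimately show "z = w" by auto
  qed
  have EX: "(\<lambda>z. exp (c * L (z\<^sup>2))) has_fps_expansion E c" for c
  proof -
    have "(\<lambda>z. exp (c * L z)) has_fps_expansion (fps_exp c oo ?G)"
      using has_fps_expansion_compose[OF has_fps_expansion_exp[of c] \<gamma>] by (simp add: o_def)
    from has_fps_expansion_compose[OF this has_fps_expansion_fps_X_power[of 2]] show ?thesis
      by (simp add: E_def o_def)
  qed
  have "(\<Sum>n\<le>6. (real n - real 3) * (norm (fps_nth F n))\<^sup>2) \<le> 0"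
  proof (rule area_inequality[where \<Phi> = \<Phi> and A = A and Q = "[:0, -3 * \<gamma> 1, 0, -1/3:]"])
    show "A has_fps_expansion F"
      unfolding A_def F_def by (intro fps_expansion_intros EX)
    show "\<Phi> holomorphic_on ball 0 1" "A holomorphic_on ball 0 1"
      unfolding \<Phi>_def A_def by (intro holomorphic_intros L2; simp)+
    fix z :: complex assume "z \<in> ball 0 1 - {0}"
    define e where "e = exp (-1/2 * L (z\<^sup>2))"
    have "exp (-3/2 * L (z\<^sup>2)) = e ^ 3"
      unfolding e_def by (simp flip: exp_of_nat_mult)
    then have "A z = -1/3 * e ^ 3 + -3 * \<gamma> 1 * (z\<^sup>2 * e)"
      by (simp only: A_def e_def[symmetric])
    moreover have "1 / \<Phi> z = e / z"
      by (simp add: \<Phi>_def e_def exp_minus field_simps)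
    ultimately show "A z = z ^ 3 * poly [:0, -3 * \<gamma> 1, 0, -1/3:] (1 / \<Phi> z)"
      using \<open>z \<in> _\<close> by (simp only:) (simp add: field_simps eval_nat_numeral)
  qed (use inj in \<open>auto simp: \<Phi>_def\<close>)
  moreover have "{..6::nat} = {0, 1, 2, 3, 4, 5, 6}" by auto
  moreover have "fps_nth (E c) (2 * n) = fps_nth (fps_exp c oo ?G) n" "fps_nth (E c) (Suc (2 * n)) = 0" for c n
    by (simp_all add: E_def fps_compose_X_square_nth)
  note this(1)[of _ 0] this(1)[of _ 1] this(1)[of _ 2] this(1)[of _ 3] this(2)[of _ 0] this(2)[of _ 1] this(2)[of _ 2]
  then have "fps_nth F 0 = -1/3" "fps_nth F 1 = 0" "fps_nth F 2 = -2 * \<gamma> 1" "fps_nth F 3 = 0"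
     "fps_nth F 4 = \<gamma> 2 + 3 / 2 * (\<gamma> 1)\<^sup>2" "fps_nth F 5 = 0" "fps_nth F 6 = \<gamma> 3"
    by (simp_all add: F_def fps_X_power_mult_nth fps_exp_compose_nth) (simp_all add: field_simps eval_nat_numeral)
  ultimately show ?thesis
    by (simp add: norm_mult norm_divide power_mult_distrib power_divide field_simps)
qed

theorem theorem1:
  fixes f :: "complex \<Rightarrow> complex" and \<gamma> :: "nat \<Rightarrow> complex"
  assumes "f \<in> class_S"
    and "log_coefficients f \<gamma>"
  shows "norm (\<gamma> 3) \<le> sqrt 133 / 15 \<and> 0.7688 \<le> sqrt 133 / 15 \<and> sqrt 133 / 15 < 0.7689"
proof -
  obtain L where L: "is_log_quotient f L"
    and sums: "\<forall>z\<in>ball 0 1. summable (\<lambda>n. \<gamma> (Suc n) * z ^ Suc n) \<and>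
      L z = 2 * (\<Sum>n. \<gamma> (Suc n) * z ^ Suc n)"
    using assms(2) unfolding log_coefficients_def by (elim exE conjE)
  have exp: "L has_fps_expansion Abs_fps (\<lambda>n. if n = 0 then 0 else 2 * \<gamma> n)"
    using sums by (intro log_quotient_has_fps_expansion) (rule bspec)
  define t where "t = (norm (\<gamma> 1))\<^sup>2"
  define x where "x = norm (\<gamma> 2 + 3 / 2 * (\<gamma> 1)\<^sup>2)"
  have odd: "x\<^sup>2 + 3 * (norm (\<gamma> 3))\<^sup>2 \<le> 4 * t + 1 / 3"
    using log_coefficients_area_odd[OF assms(1) L exp] by (simp add: x_def t_def)
  define y where "y = norm (2 * (\<gamma> 2 - (\<gamma> 1)\<^sup>2))"
  \<comment> \<open>The difference of the two quantities on the right is 5 \<gamma>_1^2, as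
    \<gamma>_2 cancels.\<close>
  have "norm (5 * (\<gamma> 1)\<^sup>2) \<le> norm (2 * (\<gamma> 2 + 3 / 2 * (\<gamma> 1)\<^sup>2)) + norm (2 * (\<gamma> 2 - (\<gamma> 1)\<^sup>2))"
    by (rule order_trans[OF _ norm_triangle_ineq4]) (simp add: algebra_simps)
  moreover have "norm (5 * (\<gamma> 1)\<^sup>2) = 5 * t"
    by (simp add: norm_mult norm_power t_def)
  moreover have "norm (2 * (\<gamma> 2 + 3 / 2 * (\<gamma> 1)\<^sup>2)) = 2 * x"
    by (simp only: norm_mult x_def norm_numeral)
  ultimately have "5 * t \<le> 2 * x + y"
    by (simp only: y_def)
  moreover have "y \<le> 1"
    unfolding y_def by (rule log_coefficients_area_first[OF assms(1) L exp])
  ultimately have x: "(5 * t - 1) / 2 \<le> x" by (simp add: field_simps)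
  \<comment> \<open>36/25 is the maximum of 4 t - ((5 t - 1) / 2)^2, and the gap to it is the square
    (5 t / 2 - 13/10)^2. For t < 1/5 the lower bound on x is negative and cannot be squared, but
    there 4 t < 4/5 already suffices.\<close>
  have "4 * t - x\<^sup>2 \<le> 36 / 25"
  proof (cases "5 * t - 1 \<ge> 0")
    case True
    then have "((5 * t - 1) / 2)\<^sup>2 \<le> x\<^sup>2" using x by (intro power_mono) auto
    moreover have "0 \<le> (5 / 2 * t - 13 / 10)\<^sup>2" by simp
    ultimately show ?thesis by (simp add: power2_eq_square field_simps)
  next
    case False
    moreover have "0 \<le> x\<^sup>2" by simp
    ultimately show ?thesis by linarith
  qed
  \<comment> \<open>(36/25 + 1/3) / 3 = 133/225.\<close>
  then have "(norm (\<gamma> 3))\<^sup>2 \<le> 133 / 15\<^sup>2" using odd by simp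
  then have "norm (\<gamma> 3) \<le> sqrt (133 / 15\<^sup>2)" by (rule real_le_rsqrt)
  moreover have "sqrt (133 / 15\<^sup>2) = sqrt 133 / 15" by (simp add: real_sqrt_divide)
  moreover have "0.7688 * 15 \<le> sqrt 133" by (rule real_le_rsqrt) (simp add: power2_eq_square)
  moreover have "sqrt 133 < 0.7689 * 15" by (rule real_less_lsqrt) (simp_all add: power2_eq_square)
  ultimately show ?thesis by simp
qed

end
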